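(* Let $1\le n\le3$, $0<\alpha\le1$, $A,B>0$, $\rho_\pm>0$ and $u_\pm\in\mathbb{R}$. The Riemann problem for the extended Chaplygin gas equations $\rho_t+(\rho u)_x=0$, $(\rho u)_t+(\rho u^2+A\rho^n-B\rho^{-\alpha})_x=0$ with data $(\rho,u)(x,0)=(\rho_\pm,u_\pm)$ for $\pm x>0$ has a self-similar solution connecting $(\rho_-,u_-)$ to $(\rho_+,u_+)$ through an intermediate constant state, of the following form: (1) if $(\rho_+,u_+)\in R_1R_2(\rho_-,u_-)$: a 1-rarefaction wave followed by a 2-rarefaction wave ($R_1+R_2$); (2) if $(\rho_+,u_+)\in R_1S_2(\rho_-,u_-)$: a 1-rarefaction wave followed by a 2-shock ($R_1+S_2$); (3) if $(\rho_+,u_+)\in S_1R_2(\rho_-,u_-)$: a 1-shock followed by a 2-rarefaction wave ($S_1+R_2$); (4) if $(\rho_+,u_+)\in S_1S_2(\rho_-,u_-)$: a 1-shock followed by a 2-shock ($S_1+S_2$).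
   Context: Put $c(\rho)=\sqrt{An\rho^{n-1}+\alpha B\rho^{-\alpha-1}}$ and, for $a,b>0$, $\Phi(a,b)=\sqrt{\frac{a-b}{ab}\big(A(a^n-b^n)-B(\frac1{a^\alpha}-\frac1{b^\alpha})\big)}$. For a left state $(\rho_l,u_l)$ with $\rho_l>0$, the states $(\rho,u)$ that can be connected to it on the right by a single wave are: - 1-rarefaction wave: $u-u_l=-\int_{\rho_l}^\rho\frac{c(s)}{s}ds$, $\rho<\rho_l$, with $\xi=x/t=u-c(\rho)$ along the wave; - 2-rarefaction wave: $u-u_l=\int_{\rho_l}^\rho\frac{c(s)}{s}ds$, $\rho>\rho_l$, with $\xi=x/t=u+c(\rho)$ along the wave; - 1-shock: $u-u_l=-\Phi(\rho,\rho_l)$, $\rho>\rho_l$, with speed $\sigma_1=\frac{\rho u-\rho_lu_l}{\rho-\rho_l}$; - 2-shock: $u-u_l=-\Phi(\rho,\rho_l)$, $\rho<\rho_l$, with speed $\sigma_2=\frac{\rho u-\rho_lu_l}{\rho-\rho_l}$. The four wave curves through $(\rho_-,u_-)$ divide the half plane $\{\rho>0\}$ into the four regions: - $R_1R_2(\rho_-,u_-)$: $u-u_->\big|\int_{\rho_-}^\rho\frac{c(s)}{s}ds\big|$; - $R_1S_2(\rho_-,u_-)$: $\rho<\rho_-$ and $-\Phi(\rho,\rho_-)<u-u_-<\int_\rho^{\rho_-}\frac{c(s)}{s}ds$; - $S_1R_2(\rho_-,u_-)$: $\rho>\rho_-$ and $-\Phi(\rho,\rho_-)<u-u_-<\int_{\rho_-}^\rho\frac{c(s)}{s}ds$;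 - $S_1S_2(\rho_-,u_-)$: $u-u_-<-\Phi(\rho,\rho_-)$. *)

theory Defs
  imports "HOL-Analysis.Analysis"
begin

text \<open>
  States are pairs \<open>(\<rho>, u)\<close>; the parameters \<open>n \<alpha> A B\<close> are those of the pressure law.
  The exponent \<open>n\<close> is real.
\<close>

type_synonym state = "real \<times> real"

definition pressure :: "real \<Rightarrow> real \<Rightarrow> real \<Rightarrow> real \<Rightarrow> real \<Rightarrow> real" where
  "pressure n \<alpha> A B \<rho> = A * \<rho> powr n - B * \<rho> powr (- \<alpha>)"

definition sound_speed :: "real \<Rightarrow> real \<Rightarrow> real \<Rightarrow> real \<Rightarrow> real \<Rightarrow> real" where
  "sound_speed n \<alpha> A B \<rho> = sqrt (A * n * \<rho> powr (n - 1) + \<alpha> * B * \<rho> powr (- \<alpha> - 1))"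

text \<open>The interval integral is oriented: it changes sign when \<open>a\<close> and \<open>b\<close> are swapped.\<close>

definition rarefaction_integral :: "real \<Rightarrow> real \<Rightarrow> real \<Rightarrow> real \<Rightarrow> real \<Rightarrow> real \<Rightarrow> real" where
  "rarefaction_integral n \<alpha> A B a b =
     (LBINT s=ereal a..ereal b. sound_speed n \<alpha> A B s / s)"

definition shock_fun :: "real \<Rightarrow> real \<Rightarrow> real \<Rightarrow> real \<Rightarrow> real \<Rightarrow> real \<Rightarrow> real" where
  "shock_fun n \<alpha> A B a b =
     sqrt ((a - b) / (a * b)
           * (A * (a powr n - b powr n) - B * (1 / a powr \<alpha> - 1 / b powr \<alpha>)))"

definition char_speed1 :: "real \<Rightarrow> real \<Rightarrow> real \<Rightarrow> real \<Rightarrow> state \<Rightarrow> real" where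
  "char_speed1 n \<alpha> A B q = snd q - sound_speed n \<alpha> A B (fst q)"

definition char_speed2 :: "real \<Rightarrow> real \<Rightarrow> real \<Rightarrow> real \<Rightarrow> state \<Rightarrow> real" where
  "char_speed2 n \<alpha> A B q = snd q + sound_speed n \<alpha> A B (fst q)"

definition shock_speed :: "state \<Rightarrow> state \<Rightarrow> real" where
  "shock_speed l r = (fst r * snd r - fst l * snd l) / (fst r - fst l)"

definition R1_curve :: "real \<Rightarrow> real \<Rightarrow> real \<Rightarrow> real \<Rightarrow> state \<Rightarrow> state set" where
  "R1_curve n \<alpha> A B l = {(\<rho>, u). 0 < \<rho> \<and> \<rho> < fst l \<and>
     u - snd l = - rarefaction_integral n \<alpha> A B (fst l) \<rho>}"

definition R2_curve :: "real \<Rightarrow> real \<Rightarrow> real \<Rightarrow> real \<Rightarrow> state \<Rightarrow> state set" where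
  "R2_curve n \<alpha> A B l = {(\<rho>, u). \<rho> > fst l \<and>
     u - snd l = rarefaction_integral n \<alpha> A B (fst l) \<rho>}"

definition S1_curve :: "real \<Rightarrow> real \<Rightarrow> real \<Rightarrow> real \<Rightarrow> state \<Rightarrow> state set" where
  "S1_curve n \<alpha> A B l = {(\<rho>, u). \<rho> > fst l \<and>
     u - snd l = - shock_fun n \<alpha> A B \<rho> (fst l)}"

definition S2_curve :: "real \<Rightarrow> real \<Rightarrow> real \<Rightarrow> real \<Rightarrow> state \<Rightarrow> state set" where
  "S2_curve n \<alpha> A B l = {(\<rho>, u). 0 < \<rho> \<and> \<rho> < fst l \<and>
     u - snd l = - shock_fun n \<alpha> A B \<rho> (fst l)}"

text \<open>
  A self-similar function is given by its profile \<open>V\<close> in the variable \<open>\<xi> = x / t\<close>.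
  The predicates below say that \<open>V\<close> is, on the (possibly degenerate) interval
  \<open>[a, b]\<close> of speeds, a single wave joining the state \<open>l\<close> on its left to \<open>r\<close> on its right.
  The value of \<open>V\<close> on a shock itself is left open.
\<close>

definition R1_wave ::
  "real \<Rightarrow> real \<Rightarrow> real \<Rightarrow> real \<Rightarrow> (real \<Rightarrow> state) \<Rightarrow> real \<Rightarrow> real \<Rightarrow> state \<Rightarrow> state \<Rightarrow> bool" where
  "R1_wave n \<alpha> A B V a b l r \<longleftrightarrow>
     r \<in> R1_curve n \<alpha> A B l \<and>
     a = char_speed1 n \<alpha> A B l \<and> b = char_speed1 n \<alpha> A B r \<and> a < b \<and>
     V a = l \<and> V b = r \<and>
     (\<forall>\<xi>\<in>{a<..<b}. V \<xi> \<in> R1_curve n \<alpha> A B l \<and> \<xi> = char_speed1 n \<alpha> A B (V \<xi>))"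

definition R2_wave ::
  "real \<Rightarrow> real \<Rightarrow> real \<Rightarrow> real \<Rightarrow> (real \<Rightarrow> state) \<Rightarrow> real \<Rightarrow> real \<Rightarrow> state \<Rightarrow> state \<Rightarrow> bool" where
  "R2_wave n \<alpha> A B V a b l r \<longleftrightarrow>
     r \<in> R2_curve n \<alpha> A B l \<and>
     a = char_speed2 n \<alpha> A B l \<and> b = char_speed2 n \<alpha> A B r \<and> a < b \<and>
     V a = l \<and> V b = r \<and>
     (\<forall>\<xi>\<in>{a<..<b}. V \<xi> \<in> R2_curve n \<alpha> A B l \<and> \<xi> = char_speed2 n \<alpha> A B (V \<xi>))"

definition S1_wave ::
  "real \<Rightarrow> real \<Rightarrow> real \<Rightarrow> real \<Rightarrow> (real \<Rightarrow> state) \<Rightarrow> real \<Rightarrow> real \<Rightarrow> state \<Rightarrow> state \<Rightarrow> bool" where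
  "S1_wave n \<alpha> A B V a b l r \<longleftrightarrow>
     r \<in> S1_curve n \<alpha> A B l \<and> a = shock_speed l r \<and> b = shock_speed l r"

definition S2_wave ::
  "real \<Rightarrow> real \<Rightarrow> real \<Rightarrow> real \<Rightarrow> (real \<Rightarrow> state) \<Rightarrow> real \<Rightarrow> real \<Rightarrow> state \<Rightarrow> state \<Rightarrow> bool" where
  "S2_wave n \<alpha> A B V a b l r \<longleftrightarrow>
     r \<in> S2_curve n \<alpha> A B l \<and> a = shock_speed l r \<and> b = shock_speed l r"

definition wave_followed_by ::
  "((real \<Rightarrow> state) \<Rightarrow> real \<Rightarrow> real \<Rightarrow> state \<Rightarrow> state \<Rightarrow> bool) \<Rightarrow>
   ((real \<Rightarrow> state) \<Rightarrow> real \<Rightarrow> real \<Rightarrow> state \<Rightarrow> state \<Rightarrow> bool) \<Rightarrow>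
   (real \<Rightarrow> state) \<Rightarrow> state \<Rightarrow> state \<Rightarrow> bool" where
  "wave_followed_by W1 W2 V l r \<longleftrightarrow>
     (\<exists>m a1 b1 a2 b2.
        W1 V a1 b1 l m \<and> W2 V a2 b2 m r \<and> b1 < a2 \<and>
        (\<forall>\<xi><a1. V \<xi> = l) \<and> (\<forall>\<xi>\<in>{b1<..<a2}. V \<xi> = m) \<and> (\<forall>\<xi>>b2. V \<xi> = r))"

text \<open>
  Points of the plane are \<open>(x, t)\<close>. The test functions do not have to vanish at \<open>t = 0\<close>, so that
  the weak form of a conservation law \<open>w\<^sub>t + f\<^sub>x = 0\<close> on \<open>t > 0\<close> also contains its
  initial data \<open>w0\<close>.
\<close>

definition test_function ::
  "(real \<times> real \<Rightarrow> real) \<Rightarrow> (real \<times> real \<Rightarrow> real) \<Rightarrow> (real \<times> real \<Rightarrow> real) \<Rightarrow> bool" where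
  "test_function \<phi> \<phi>x \<phi>t \<longleftrightarrow>
     (\<forall>p. (\<phi> has_derivative (\<lambda>(h, k). \<phi>x p * h + \<phi>t p * k)) (at p)) \<and>
     continuous_on UNIV \<phi>x \<and> continuous_on UNIV \<phi>t \<and>
     compact (closure {p. \<phi> p \<noteq> 0})"

definition weak_conservation_law ::
  "(real \<times> real \<Rightarrow> real) \<Rightarrow> (real \<times> real \<Rightarrow> real) \<Rightarrow> (real \<Rightarrow> real) \<Rightarrow> bool" where
  "weak_conservation_law w f w0 \<longleftrightarrow>
     (\<forall>K. compact K \<longrightarrow> set_integrable lborel (K \<inter> UNIV \<times> {0<..}) w \<and>
                        set_integrable lborel (K \<inter> UNIV \<times> {0<..}) f) \<and>
     (\<forall>\<phi> \<phi>x \<phi>t. test_function \<phi> \<phi>x \<phi>t \<longrightarrow>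
        (LINT p:UNIV \<times> {0<..}|lborel. w p * \<phi>t p + f p * \<phi>x p)
        + (LINT x|lborel. w0 x * \<phi> (x, 0)) = 0)"

definition riemann_weak_solution ::
  "real \<Rightarrow> real \<Rightarrow> real \<Rightarrow> real \<Rightarrow> state \<Rightarrow> state \<Rightarrow> (real \<times> real \<Rightarrow> state) \<Rightarrow> bool" where
  "riemann_weak_solution n \<alpha> A B l r q \<longleftrightarrow>
     (let \<rho> = (\<lambda>p. fst (q p)); u = (\<lambda>p. snd (q p));
          q0 = (\<lambda>x::real. if x < 0 then l else r)
      in (\<forall>x. \<forall>t>0. \<rho> (x, t) > 0) \<and>
         weak_conservation_law \<rho> (\<lambda>p. \<rho> p * u p) (\<lambda>x. fst (q0 x)) \<and>
         weak_conservation_law (\<lambda>p. \<rho> p * u p)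
           (\<lambda>p. \<rho> p * (u p)\<^sup>2 + pressure n \<alpha> A B (\<rho> p))
           (\<lambda>x. fst (q0 x) * snd (q0 x)))"

definition self_similar_solution ::
  "real \<Rightarrow> real \<Rightarrow> real \<Rightarrow> real \<Rightarrow> state \<Rightarrow> state \<Rightarrow> (real \<Rightarrow> state) \<Rightarrow> bool" where
  "self_similar_solution n \<alpha> A B l r V \<longleftrightarrow>
     riemann_weak_solution n \<alpha> A B l r (\<lambda>(x, t). V (x / t))"

definition region_R1R2 :: "real \<Rightarrow> real \<Rightarrow> real \<Rightarrow> real \<Rightarrow> state \<Rightarrow> state set" where
  "region_R1R2 n \<alpha> A B l = {(\<rho>, u). \<rho> > 0 \<and>
     u - snd l > \<bar>rarefaction_integral n \<alpha> A B (fst l) \<rho>\<bar>}"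

definition region_R1S2 :: "real \<Rightarrow> real \<Rightarrow> real \<Rightarrow> real \<Rightarrow> state \<Rightarrow> state set" where
  "region_R1S2 n \<alpha> A B l = {(\<rho>, u). \<rho> > 0 \<and> \<rho> < fst l \<and>
     - shock_fun n \<alpha> A B \<rho> (fst l) < u - snd l \<and>
     u - snd l < rarefaction_integral n \<alpha> A B \<rho> (fst l)}"

definition region_S1R2 :: "real \<Rightarrow> real \<Rightarrow> real \<Rightarrow> real \<Rightarrow> state \<Rightarrow> state set" where
  "region_S1R2 n \<alpha> A B l = {(\<rho>, u). \<rho> > 0 \<and> \<rho> > fst l \<and>
     - shock_fun n \<alpha> A B \<rho> (fst l) < u - snd l \<and>
     u - snd l < rarefaction_integral n \<alpha> A B (fst l) \<rho>}"

definition region_S1S2 :: "real \<Rightarrow> real \<Rightarrow> real \<Rightarrow> real \<Rightarrow> state \<Rightarrow> state set" where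
  "region_S1S2 n \<alpha> A B l = {(\<rho>, u). \<rho> > 0 \<and>
     u - snd l < - shock_fun n \<alpha> A B \<rho> (fst l)}"

end

theory Submission
  imports Defs
begin

text \<open>
  The intermediate state is found by the intermediate value theorem on the composed wave curves:
  the velocity jump is a continuous function of the intermediate density, the regions prescribe
  its sign at the relevant end points, and the other end is reached because the rarefaction
  integral diverges at density \<open>0\<close> and the shock jump diverges at infinity. The waves are ordered
  because a 1-shock is slower, and a 2-shock faster, than the intermediate velocity.

  For a self-similar pair \<open>W (x / t)\<close>, \<open>F (x / t)\<close> the weak form reduces to one ordinary
  differential equation: \<open>G = F - \<xi> W\<close> is continuous with \<open>G' = - W\<close> off a finite set.
  On \<open>t > \<epsilon>\<close> the substitution \<open>x = \<xi> t\<close> and one integration by parts in \<open>\<xi>\<close> turn the integrand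
  into \<open>W \<xi> * d/dt (t * \<phi> (\<xi> t, t))\<close>, leaving only the trace at \<open>t = \<epsilon>\<close>, which tends to the
  initial data. Across a shock, continuity of \<open>G\<close> is the Rankine-Hugoniot condition.
\<close>

section \<open>Weak form of self-similar conservation laws\<close>

text \<open>The product vanishes off the box and is at most \<open>C * D\<close> on it, with
  \<open>D\<close> a bound for \<open>h\<close> there. Only measurability and a bound are asked of
  \<open>g\<close>, because profiles jump at shocks; the support condition is put on the product so
  that an indicator inside \<open>g\<close> can supply part of it.\<close>

lemma integrable_bounded_mult_continuous:
  fixes g h :: "'a::euclidean_space \<Rightarrow> real"
  assumes g [measurable]: "g \<in> borel_measurable borel" and bnd: "\<And>x. \<bar>g x\<bar> \<le> C"
    and h: "continuous_on UNIV h"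
    and supp: "\<And>x. x \<notin> cbox a b \<Longrightarrow> g x * h x = 0"
  shows "integrable lborel (\<lambda>x. g x * h x)"
proof -
  have [measurable]: "h \<in> borel_measurable borel"
    using h by (rule borel_measurable_continuous_onI)
  have "bounded (h ` cbox a b)"
    by (intro compact_imp_bounded compact_continuous_image continuous_on_subset[OF h]) auto
  then obtain D where D: "\<And>x. x \<in> cbox a b \<Longrightarrow> \<bar>h x\<bar> \<le> D"
    unfolding bounded_iff by auto
  have C: "0 \<le> C"
    using bnd[of undefined] by linarith
  show ?thesis
  proof (rule integrableI_bounded_set[where A="cbox a b" and B="C * D"])
    have "norm (g x * h x) \<le> C * D" if "x \<in> cbox a b" for x
      using bnd[of x] D[OF that] C by (auto simp: abs_mult intro!: mult_mono)
    then show "AE x in lborel. x \<in> cbox a b \<longrightarrow> norm (g x * h x) \<le> C * D"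
      by simp
    show "AE x in lborel. x \<notin> cbox a b \<longrightarrow> g x * h x = 0"
      using supp by auto
    show "emeasure lborel (cbox a b) < \<infinity>"
      using emeasure_lborel_cbox_finite by auto
  qed auto
qed

text \<open>The gauge-integral form of the fundamental theorem tolerates a finite exceptional set,
  which will hold the shocks and the edges of the fans. Integrability of \<open>f\<close> carries
  the value over to the Lebesgue integral.\<close>

lemma integral_FTC_strong:
  fixes F f :: "real \<Rightarrow> real"
  assumes "finite S" "a \<le> b" and int: "integrable lborel f"
    and supp: "\<And>x. x \<notin> {a..b} \<Longrightarrow> f x = 0"
    and cont: "continuous_on {a..b} F"
    and deriv: "\<And>x. x \<in> {a<..<b} - S \<Longrightarrow> (F has_real_derivative f x) (at x)"
  shows "integral\<^sup>L lborel f = F b - F a"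
proof -
  have "(f has_integral (F b - F a)) {a..b}"
    using assms(1,2) deriv cont
    by (intro fundamental_theorem_of_calculus_interior_strong)
       (auto simp: has_real_derivative_iff_has_vector_derivative)
  then have "(f has_integral (F b - F a)) UNIV"
    by (rule has_integral_on_superset) (use supp in auto)
  with has_integral_integral_lborel[OF int] show ?thesis
    by (rule has_integral_unique)
qed

text \<open>Off its closed support \<phi> is zero on an open set, so uniqueness of the derivative
  makes \<open>\<phi>x\<close> and \<open>\<phi>t\<close> vanish there as well. A ball around the
  support provides \<open>R\<close>.\<close>

lemma test_function_support:
  assumes "test_function \<phi> \<phi>x \<phi>t"
  obtains R where "R > 0"
    "\<And>x t. R \<le> \<bar>x\<bar> \<or> R \<le> \<bar>t\<bar> \<Longrightarrow> \<phi> (x, t) = 0 \<and> \<phi>x (x, t) = 0 \<and> \<phi>t (x, t) = 0"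
proof -
  let ?K = "closure {p. \<phi> p \<noteq> 0}"
  have der: "\<And>p. (\<phi> has_derivative (\<lambda>(h, k). \<phi>x p * h + \<phi>t p * k)) (at p)"
    and "compact ?K"
    using assms by (auto simp: test_function_def)
  then obtain R where R: "R > 0" "\<And>p. p \<in> ?K \<Longrightarrow> norm p < R"
    by (metis bounded_pos_less compact_imp_bounded)
  have out: "\<phi> p = 0 \<and> \<phi>x p = 0 \<and> \<phi>t p = 0" if p: "p \<notin> ?K" for p
  proof -
    have "((\<lambda>_. 0) has_derivative (\<lambda>(h, k). \<phi>x p * h + \<phi>t p * k)) (at p)"
    proof (rule has_derivative_transform_within_open[OF der])
      show "open (- ?K)" by auto
      show "\<phi> q = 0" if "q \<in> - ?K" for q
        using that closure_subset[of "{p. \<phi> p \<noteq> 0}"] by auto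
    qed (use p in auto)
    then have "(\<lambda>(h, k). \<phi>x p * h + \<phi>t p * k) = (\<lambda>_. 0)"
      by (rule has_derivative_unique) auto
    then have "\<phi>x p * h + \<phi>t p * k = 0" for h k
      by (auto simp: fun_eq_iff)
    from this[of 1 0] this[of 0 1] show ?thesis
      using p closure_subset[of "{p. \<phi> p \<noteq> 0}"] by auto
  qed
  have "(x, t) \<notin> ?K" if "R \<le> \<bar>x\<bar> \<or> R \<le> \<bar>t\<bar>" for x t
    using R(2)[of "(x, t)"] norm_fst_le[of x t] norm_snd_le[of t x] that by fastforce
  with out R(1) that show ?thesis
    by blast
qed

lemma ratio_measurable [measurable]:
  "(\<lambda>p. fst p / snd p :: real) \<in> borel_measurable (borel :: (real \<times> real) measure)"
  by (intro borel_measurable_divide borel_measurable_continuous_onI continuous_intros)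

lemma upper_measurable [measurable]: "UNIV \<times> {e<..} \<in> sets (borel :: (real \<times> real) measure)"
  by (intro borel_open open_Times) auto

section \<open>The weak identity for one scalar law and one test function\<close>

context
  fixes W F :: "real \<Rightarrow> real" and C :: real and S :: "real set" and a b wl wr :: real
    and \<phi> \<phi>x \<phi>t :: "real \<times> real \<Rightarrow> real" and R :: real
  assumes W_meas [measurable]: "W \<in> borel_measurable borel"
    and F_meas [measurable]: "F \<in> borel_measurable borel"
    and W_bound: "\<And>\<xi>. \<bar>W \<xi>\<bar> \<le> C" and F_bound: "\<And>\<xi>. \<bar>F \<xi>\<bar> \<le> C"
    and fin: "finite S"
    and G_cont: "continuous_on UNIV (\<lambda>\<xi>. F \<xi> - \<xi> * W \<xi>)"
    and G_deriv: "\<And>\<xi>. \<xi> \<notin> S \<Longrightarrow> ((\<lambda>\<xi>. F \<xi> - \<xi> * W \<xi>) has_real_derivative - W \<xi>) (at \<xi>)"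
    and W_left: "\<And>\<xi>. \<xi> < a \<Longrightarrow> W \<xi> = wl" and W_right: "\<And>\<xi>. \<xi> > b \<Longrightarrow> W \<xi> = wr"
    and test: "test_function \<phi> \<phi>x \<phi>t"
    and R_pos: "R > 0"
    and supp: "\<And>x t. R \<le> \<bar>x\<bar> \<or> R \<le> \<bar>t\<bar> \<Longrightarrow> \<phi> (x, t) = 0 \<and> \<phi>x (x, t) = 0 \<and> \<phi>t (x, t) = 0"
begin

lemma test_has_derivative: "(\<phi> has_derivative (\<lambda>(h, k). \<phi>x p * h + \<phi>t p * k)) (at p)"
  using test unfolding test_function_def by blast

lemma test_continuous:
  "continuous_on UNIV \<phi>" "continuous_on UNIV \<phi>x" "continuous_on UNIV \<phi>t"
proof -
  show "continuous_on UNIV \<phi>"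
    using has_derivative_continuous[OF test_has_derivative] by (simp add: continuous_at_imp_continuous_on)
  show "continuous_on UNIV \<phi>x" "continuous_on UNIV \<phi>t"
    using test unfolding test_function_def by blast+
qed

lemma test_measurable [measurable]:
  "\<phi> \<in> borel_measurable borel" "\<phi>x \<in> borel_measurable borel" "\<phi>t \<in> borel_measurable borel"
  by (intro borel_measurable_continuous_onI test_continuous)+

lemma continuous_on_test [continuous_intros]:
  assumes "continuous_on T f"
  shows "continuous_on T (\<lambda>z. \<phi> (f z))" "continuous_on T (\<lambda>z. \<phi>x (f z))"
    "continuous_on T (\<lambda>z. \<phi>t (f z))"
  using continuous_on_compose2[OF test_continuous(1) assms]
    continuous_on_compose2[OF test_continuous(2) assms]
    continuous_on_compose2[OF test_continuous(3) assms] by auto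

lemma test_chain_rule:
  assumes "(f has_real_derivative f') (at z)" "(g has_real_derivative g') (at z)"
  shows "((\<lambda>z. \<phi> (f z, g z)) has_real_derivative
    \<phi>x (f z, g z) * f' + \<phi>t (f z, g z) * g') (at z)"
proof -
  have "((\<lambda>z. (f z, g z)) has_derivative (\<lambda>h. (f' * h, g' * h))) (at z)"
    using assms by (intro has_derivative_Pair) (auto simp: has_field_derivative_def)
  from has_derivative_compose[OF this test_has_derivative]
  have "((\<lambda>z. \<phi> (f z, g z)) has_derivative
      (\<lambda>h. \<phi>x (f z, g z) * (f' * h) + \<phi>t (f z, g z) * (g' * h))) (at z)"
    by simp
  then show ?thesis
    unfolding has_field_derivative_def by (rule has_derivative_eq_rhs) (auto simp: algebra_simps)
qed

text \<open>This is the derivative in \<open>t\<close> of \<open>t * \<phi> (\<xi> * t, t)\<close>,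
  taken along the ray x = \<xi> t; the factor \<open>t\<close> is the Jacobian of the
  substitution.\<close>

definition "dil \<xi> t = \<phi> (\<xi> * t, t) + t * \<phi>t (\<xi> * t, t) + \<xi> * t * \<phi>x (\<xi> * t, t)"

lemma dil_continuous: "continuous_on UNIV (\<lambda>(\<xi>, t). dil \<xi> t)"
  unfolding dil_def case_prod_beta by (intro continuous_intros)

lemma far_out:
  assumes "t > 0" "\<xi> \<notin> {- (R / t)..R / t}"
  shows "\<phi> (\<xi> * t, t) = 0" "\<phi>x (\<xi> * t, t) = 0" "\<phi>t (\<xi> * t, t) = 0"
proof -
  have "R / t \<le> \<bar>\<xi>\<bar>" using assms by auto
  then have "R \<le> \<bar>\<xi> * t\<bar>" using assms(1) by (simp add: field_simps abs_mult)
  then show "\<phi> (\<xi> * t, t) = 0" "\<phi>x (\<xi> * t, t) = 0" "\<phi>t (\<xi> * t, t) = 0"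
    using supp by auto
qed

text \<open>Off \<open>S\<close> the integrand is the derivative of
  \<open>(F \<xi> - \<xi> * W \<xi>) * \<phi> (\<xi> * t, t)\<close>. This primitive is continuous
  across the jumps of \<open>W\<close>, so they contribute nothing, and it vanishes at \<xi> = R / t
  and \<xi> = - R / t, where |x| = R.\<close>

lemma G_integral:
  assumes t: "t > 0"
  shows "integral\<^sup>L lborel (\<lambda>\<xi>. (F \<xi> - \<xi> * W \<xi>) * (t * \<phi>x (\<xi> * t, t)) - W \<xi> * \<phi> (\<xi> * t, t)) = 0"
    (is "integral\<^sup>L lborel ?f = 0")
    and "integrable lborel (\<lambda>\<xi>. (F \<xi> - \<xi> * W \<xi>) * (t * \<phi>x (\<xi> * t, t)) - W \<xi> * \<phi> (\<xi> * t, t))"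
proof -
  let ?M = "R / t"
  have M: "?M > 0" using t R_pos by simp
  show int: "integrable lborel ?f"
  proof (intro Bochner_Integration.integrable_diff)
    \<comment> \<open>\<open>F \<xi> - \<xi> * W \<xi>\<close> is continuous but need not be
      bounded, so it joins the continuous factor and the bounded measurable factor is the constant
      1.\<close>
    have "integrable lborel (\<lambda>\<xi>. 1 * ((F \<xi> - \<xi> * W \<xi>) * (t * \<phi>x (\<xi> * t, t))))"
      by (intro integrable_bounded_mult_continuous[where a="-?M" and b="?M" and C=1]
          continuous_intros G_cont) (use t in \<open>auto simp del: atLeastAtMost_iff simp: far_out\<close>)
    then show "integrable lborel (\<lambda>\<xi>. (F \<xi> - \<xi> * W \<xi>) * (t * \<phi>x (\<xi> * t, t)))"
      by simp
    show "integrable lborel (\<lambda>\<xi>. W \<xi> * \<phi> (\<xi> * t, t))"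
      by (intro integrable_bounded_mult_continuous[where a="-?M" and b="?M" and C=C]
          continuous_intros W_bound) (use t in \<open>auto simp del: atLeastAtMost_iff simp: far_out\<close>)
  qed
  have "integral\<^sup>L lborel ?f =
      (F ?M - ?M * W ?M) * \<phi> (?M * t, t) - (F (-?M) - (-?M) * W (-?M)) * \<phi> (-?M * t, t)"
  proof (rule integral_FTC_strong[where F="\<lambda>\<xi>. (F \<xi> - \<xi> * W \<xi>) * \<phi> (\<xi> * t, t)", OF fin _ int])
    show "?f \<xi> = 0" if "\<xi> \<notin> {- ?M..?M}" for \<xi>
      using far_out[OF t that] by simp
    show "continuous_on {- ?M..?M} (\<lambda>\<xi>. (F \<xi> - \<xi> * W \<xi>) * \<phi> (\<xi> * t, t))"
      by (intro continuous_intros continuous_on_subset[OF G_cont]) auto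
    fix \<xi> assume "\<xi> \<in> {- ?M<..<?M} - S"
    then have "\<xi> \<notin> S" by simp
    have "((\<lambda>\<xi>. \<phi> (\<xi> * t, t)) has_real_derivative (\<phi>x (\<xi> * t, t) * t + \<phi>t (\<xi> * t, t) * 0)) (at \<xi>)"
      by (intro test_chain_rule) (auto intro!: derivative_eq_intros)
    from DERIV_mult[OF G_deriv[OF \<open>\<xi> \<notin> S\<close>] this]
    show "((\<lambda>\<xi>. (F \<xi> - \<xi> * W \<xi>) * \<phi> (\<xi> * t, t)) has_real_derivative ?f \<xi>) (at \<xi>)"
      by (simp add: algebra_simps)
  qed (use M in auto)
  moreover have "\<phi> (?M * t, t) = 0" "\<phi> (-?M * t, t) = 0"
    using supp[of "?M * t"] supp[of "-?M * t"] t R_pos by (auto simp: abs_mult)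
  ultimately show "integral\<^sup>L lborel ?f = 0"
    by simp
qed

text \<open>After x = \<xi> t, adding and subtracting \<open>W \<xi> * \<phi>\<close> and
  \<open>\<xi> * t * W \<xi> * \<phi>x\<close> splits the integrand into
  \<open>W \<xi> * dil \<xi> t\<close> and the exact \<xi>-derivative of \<open>G_integral\<close>,
  whose integral is 0.\<close>

lemma slice_integral:
  assumes t: "t > 0"
  shows "(LINT x|lborel. W (x / t) * \<phi>t (x, t) + F (x / t) * \<phi>x (x, t)) =
    (LINT \<xi>|lborel. W \<xi> * dil \<xi> t)"
proof -
  let ?f = "\<lambda>\<xi>. (F \<xi> - \<xi> * W \<xi>) * (t * \<phi>x (\<xi> * t, t)) - W \<xi> * \<phi> (\<xi> * t, t)"
  have "(LINT x|lborel. W (x / t) * \<phi>t (x, t) + F (x / t) * \<phi>x (x, t)) =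
    t * (LINT \<xi>|lborel. W \<xi> * \<phi>t (\<xi> * t, t) + F \<xi> * \<phi>x (\<xi> * t, t))"
    using t by (subst lborel_integral_real_affine[where c=t and t=0]) (auto simp: mult.commute)
  also have "\<dots> = (LINT \<xi>|lborel. t * (W \<xi> * \<phi>t (\<xi> * t, t) + F \<xi> * \<phi>x (\<xi> * t, t)))"
    by simp
  also have "\<dots> = (LINT \<xi>|lborel. W \<xi> * dil \<xi> t + ?f \<xi>)"
    by (simp add: dil_def algebra_simps)
  also have "\<dots> = (LINT \<xi>|lborel. W \<xi> * dil \<xi> t) + integral\<^sup>L lborel ?f"
  proof (rule Bochner_Integration.integral_add[OF _ G_integral(2)[OF t]])
    show "integrable lborel (\<lambda>\<xi>. W \<xi> * dil \<xi> t)"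
      unfolding dil_def
      by (intro integrable_bounded_mult_continuous[where a="-(R/t)" and b="R/t" and C=C]
          continuous_intros W_bound)
         (use t in \<open>auto simp del: atLeastAtMost_iff simp: far_out\<close>)
  qed
  finally show ?thesis
    using G_integral(1)[OF t] by simp
qed

text \<open>The primitive \<open>t * \<phi> (\<xi> * t, t)\<close> is zero at
  \<open>t = e + R\<close> by the support of \<phi>, so only the lower end survives.\<close>

lemma dil_integral:
  assumes e: "e > 0"
  shows "(LINT t|lborel. indicator {e<..} t * dil \<xi> t) = - (e * \<phi> (\<xi> * e, e))"
proof -
  have out: "dil \<xi> t = 0" if "t \<ge> e + R" for t
    using supp[of "\<xi> * t" t] that e R_pos by (auto simp: dil_def)
  have 1: "continuous_on UNIV (\<lambda>t. dil \<xi> t)"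
    unfolding dil_def by (intro continuous_intros)
  have int: "integrable lborel (\<lambda>t. indicator {e<..} t * dil \<xi> t)"
    by (intro integrable_bounded_mult_continuous[where a=e and b="e+R" and C=1] 1)
       (auto simp: indicator_def out)
  have "(LINT t|lborel. indicator {e<..} t * dil \<xi> t) =
      (e + R) * \<phi> (\<xi> * (e + R), e + R) - e * \<phi> (\<xi> * e, e)"
  proof (rule integral_FTC_strong[where S="{}" and F="\<lambda>t. t * \<phi> (\<xi> * t, t)", OF _ _ int])
    show "continuous_on {e..e + R} (\<lambda>t. t * \<phi> (\<xi> * t, t))"
      by (intro continuous_intros)
    fix t assume t: "t \<in> {e<..<e + R} - {}"
    have "((\<lambda>t. \<phi> (\<xi> * t, t)) has_real_derivative (\<phi>x (\<xi> * t, t) * \<xi> + \<phi>t (\<xi> * t, t) * 1)) (at t)"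
      by (intro test_chain_rule) (auto intro!: derivative_eq_intros)
    from DERIV_mult[OF DERIV_ident this]
    show "((\<lambda>t. t * \<phi> (\<xi> * t, t)) has_real_derivative indicator {e<..} t * dil \<xi> t) (at t)"
      using t by (simp add: dil_def algebra_simps)
  qed (use R_pos out in \<open>auto simp: indicator_def\<close>)
  with supp[of "\<xi> * (e + R)" "e + R"] e R_pos show ?thesis by simp
qed

lemma integrand_integrable:
  "integrable lborel (\<lambda>p. W (fst p / snd p) * \<phi>t p + F (fst p / snd p) * \<phi>x p)"
proof (intro Bochner_Integration.integrable_add)
  have out: "\<phi>x p = 0 \<and> \<phi>t p = 0" if "p \<notin> cbox (- R, - R) (R, R)" for p
    using that supp[of "fst p" "snd p"] by (cases p) (auto simp: abs_if cbox_Pair_eq)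
  show "integrable lborel (\<lambda>p. W (fst p / snd p) * \<phi>t p)"
    by (intro integrable_bounded_mult_continuous[where a="(-R,-R)" and b="(R,R)" and C=C]
        test_continuous W_bound) (auto simp: out)
  show "integrable lborel (\<lambda>p. F (fst p / snd p) * \<phi>x p)"
    by (intro integrable_bounded_mult_continuous[where a="(-R,-R)" and b="(R,R)" and C=C]
        test_continuous F_bound) (auto simp: out)
qed

text \<open>Fubini is used twice: first with x inside, for \<open>slice_integral\<close>, then in
  the variables (\<xi>, t) with t inside, for \<open>dil_integral\<close>. Cutting at t > e confines
  \<xi> to |\<xi>| \<le> R / e on the support, which makes the integrand in (\<xi>, t) absolutely
  integrable.\<close>

lemma truncated_integral:
  assumes e: "e > 0"
  shows "(LINT p|lborel. indicator (UNIV \<times> {e<..}) p *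
      (W (fst p / snd p) * \<phi>t p + F (fst p / snd p) * \<phi>x p)) =
    - (LINT x|lborel. W (x / e) * \<phi> (x, e))"
    (is "(LINT p|lborel. ?h p) = _")
proof -
  let ?M = "R / e"
  let ?k = "\<lambda>p. (indicator {e<..} (snd p) * W (fst p)) * dil (fst p) (snd p)"
  have "integrable lborel (\<lambda>p. indicator (UNIV \<times> {e<..}) p *\<^sub>R
      (W (fst p / snd p) * \<phi>t p + F (fst p / snd p) * \<phi>x p))"
    by (intro integrable_mult_indicator integrand_integrable) auto
  then have int_h: "integrable (lborel \<Otimes>\<^sub>M lborel) (case_prod (\<lambda>x t. ?h (x, t)))"
    by (simp add: lborel_prod case_prod_unfold)
  have int_k: "integrable (lborel \<Otimes>\<^sub>M lborel) (case_prod (\<lambda>\<xi> t. ?k (\<xi>, t)))"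
  proof -
    have "integrable lborel ?k"
    proof (intro integrable_bounded_mult_continuous[where a="(-?M, e)" and b="(?M, e + R)" and C=C])
      have [measurable]: "fst \<in> borel_measurable (borel :: (real \<times> real) measure)"
        "snd \<in> borel_measurable (borel :: (real \<times> real) measure)"
        by (intro borel_measurable_continuous_onI continuous_intros)+
      show "(\<lambda>p. indicator {e<..} (snd p) * W (fst p)) \<in> borel_measurable (borel :: (real \<times> real) measure)"
        by measurable
      show "\<bar>indicator {e<..} (snd p) * W (fst p)\<bar> \<le> C" for p :: "real \<times> real"
        using W_bound[of "fst p"] by (auto simp: indicator_def)
      show "continuous_on UNIV (\<lambda>p. dil (fst p) (snd p))"
        using dil_continuous by (simp add: case_prod_beta)
      fix p :: "real \<times> real" assume p: "p \<notin> cbox (- ?M, e) (?M, e + R)"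
      obtain \<xi> t where pt: "p = (\<xi>, t)" by (cases p)
      have "dil \<xi> t = 0" if "t > e"
      proof (cases "t \<le> e + R")
        case False
        then show ?thesis
          using supp[of "\<xi> * t" t] e R_pos by (auto simp: dil_def)
      next
        case True
        with p pt that have \<xi>: "\<xi> \<notin> {- ?M..?M}" by (auto simp: cbox_Pair_eq)
        have "R / t \<le> ?M"
          using that e R_pos by (intro divide_left_mono) auto
        with \<xi> have "\<xi> \<notin> {- (R / t)..R / t}" by auto
        from far_out[OF _ this] that e show ?thesis
          by (simp add: dil_def)
      qed
      then show "?k p = 0"
        by (auto simp: pt indicator_def)
    qed
    then show ?thesis by (simp add: lborel_prod case_prod_unfold)
  qed
  have "(LINT p|lborel. ?h p) = integral\<^sup>L (lborel \<Otimes>\<^sub>M lborel) (case_prod (\<lambda>x t. ?h (x, t)))"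
    by (simp add: lborel_prod case_prod_unfold)
  also have "\<dots> = (LINT t|lborel. LINT x|lborel. ?h (x, t))"
    by (rule lborel_pair.integral_snd[OF int_h, symmetric])
  also have "\<dots> = (LINT t|lborel. LINT \<xi>|lborel. ?k (\<xi>, t))"
  proof (rule Bochner_Integration.integral_cong)
    fix t :: real
    show "(LINT x|lborel. ?h (x, t)) = (LINT \<xi>|lborel. ?k (\<xi>, t))"
      using e slice_integral[of t] by (cases "t > e") (auto simp: indicator_def)
  qed auto
  also have "\<dots> = integral\<^sup>L (lborel \<Otimes>\<^sub>M lborel) (case_prod (\<lambda>\<xi> t. ?k (\<xi>, t)))"
    by (rule lborel_pair.integral_snd[OF int_k])
  also have "\<dots> = (LINT \<xi>|lborel. LINT t|lborel. ?k (\<xi>, t))"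
    by (rule lborel_pair.integral_fst[OF int_k, symmetric])
  also have "\<dots> = (LINT \<xi>|lborel. W \<xi> * (LINT t|lborel. indicator {e<..} t * dil \<xi> t))"
    by (simp add: mult.assoc mult.left_commute[of _ "W _"])
  also have "\<dots> = - (e * (LINT \<xi>|lborel. W \<xi> * \<phi> (\<xi> * e, e)))"
    by (simp add: dil_integral[OF e] mult.left_commute[of _ e])
  also have "e * (LINT \<xi>|lborel. W \<xi> * \<phi> (\<xi> * e, e)) = (LINT x|lborel. W (x / e) * \<phi> (x, e))"
    using e by (subst (2) lborel_integral_real_affine[where c=e and t=0]) (auto simp: mult.commute)
  finally show ?thesis .
qed

text \<open>For fixed x \<noteq> 0 the ratio x / e leaves [a, b] as e tends to 0, so
  \<open>W (x / e)\<close> eventually equals \<open>wl\<close> or \<open>wr\<close>, while x = 0 is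
  a null set. The bound \<open>C * D\<close> on [-R, R] dominates.\<close>

lemma initial_trace:
  "(\<lambda>k. LINT x|lborel. W (x / (1 / real (Suc k))) * \<phi> (x, 1 / real (Suc k))) \<longlonglongrightarrow>
    (LINT x|lborel. (if x < 0 then wl else wr) * \<phi> (x, 0))"
proof -
  have "bounded (\<phi> ` cbox (- R, - R) (R, R))"
    by (intro compact_imp_bounded compact_continuous_image continuous_on_subset[OF test_continuous(1)]) auto
  then obtain D where D: "\<And>p. p \<in> cbox (- R, - R) (R, R) \<Longrightarrow> \<bar>\<phi> p\<bar> \<le> D"
    unfolding bounded_iff by auto
  have "0 \<le> \<bar>\<phi> (0, 0)\<bar>" by simp
  also have "\<dots> \<le> D" using R_pos by (intro D) (auto simp: cbox_Pair_eq)
  finally have D0: "0 \<le> D" .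
  have D': "\<bar>\<phi> (x, t)\<bar> \<le> indicator {- R..R} x * D" for x t
  proof (cases "(x, t) \<in> cbox (- R, - R) (R, R)")
    case True
    then show ?thesis using D[OF True] by (auto simp: cbox_Pair_eq)
  next
    case False
    then have "\<phi> (x, t) = 0" using supp[of x t] by (auto simp: cbox_Pair_eq abs_if)
    then show ?thesis using D0 by simp
  qed
  have C0: "0 \<le> C" using W_bound[of 0] by linarith
  have [measurable]: "(\<lambda>x. \<phi> (x, t)) \<in> borel_measurable borel" for t
    by (intro borel_measurable_continuous_onI continuous_intros)
  show ?thesis
  proof (rule integral_dominated_convergence[where w="\<lambda>x. C * (indicator {- R..R} x * D)"])
    show "integrable lborel (\<lambda>x. C * (indicator {- R..R} x * D))"
      by (intro integrable_mult_right integrable_mult_left integrable_real_indicator) (auto simp: emeasure_lborel_Icc_eq)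
    show "AE x in lborel. norm (W (x / (1 / real (Suc k))) * \<phi> (x, 1 / real (Suc k)))
        \<le> C * (indicator {- R..R} x * D)" for k
      using W_bound D' C0 by (auto simp: abs_mult intro!: mult_mono)
    have "(\<lambda>k. W (x / (1 / real (Suc k))) * \<phi> (x, 1 / real (Suc k))) \<longlonglongrightarrow>
        (if x < 0 then wl else wr) * \<phi> (x, 0)" if x: "x \<noteq> 0" for x
    proof (intro tendsto_mult)
      have "(\<lambda>k. (x, 1 / real (Suc k))) \<longlonglongrightarrow> (x, 0)"
        by (intro tendsto_Pair tendsto_const LIMSEQ_Suc lim_1_over_n)
      then show "(\<lambda>k. \<phi> (x, 1 / real (Suc k))) \<longlonglongrightarrow> \<phi> (x, 0)"
        using test_continuous(1) continuous_on_tendsto_compose[of UNIV \<phi>] by auto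
      \<comment> \<open>The number |a| + |b| is at least -a and at least b, so one bound serves both
        signs of x.\<close>
      have "eventually (\<lambda>k. \<bar>x\<bar> * real (Suc k) > \<bar>a\<bar> + \<bar>b\<bar>) sequentially"
      proof -
        have "filterlim (\<lambda>k. \<bar>x\<bar> * real (Suc k)) at_top sequentially"
          using x by (intro filterlim_tendsto_pos_mult_at_top[OF tendsto_const])
            (use filterlim_compose[OF filterlim_real_sequentially filterlim_Suc] in \<open>auto simp del: of_nat_Suc\<close>)
        then show ?thesis by (auto simp: filterlim_at_top_dense)
      qed
      then have "eventually (\<lambda>k. W (x / (1 / real (Suc k))) = (if x < 0 then wl else wr)) sequentially"
      proof eventually_elim
        case (elim k)
        then show ?case
        proof (cases "x < 0")
          case True
          then have "x * real (Suc k) < a" using elim by (simp add: abs_if split: if_splits)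
          then show ?thesis using True W_left by simp
        next
          case False
          then have "x * real (Suc k) > b" using elim by (simp add: abs_if split: if_splits)
          then show ?thesis using False W_right by simp
        qed
      qed
      then show "(\<lambda>k. W (x / (1 / real (Suc k)))) \<longlonglongrightarrow> (if x < 0 then wl else wr)"
        by (rule tendsto_eventually)
    qed
    then show "AE x in lborel. (\<lambda>k. W (x / (1 / real (Suc k))) * \<phi> (x, 1 / real (Suc k))) \<longlonglongrightarrow>
        (if x < 0 then wl else wr) * \<phi> (x, 0)"
      by (rule eventually_mono[OF AE_lborel_singleton[of 0]])
  qed measurable
qed

text \<open>Pass to the limit in \<open>truncated_integral\<close> along e = 1 / (k + 1): dominated
  convergence gives the integral over t > 0 on one side, and \<open>initial_trace\<close> gives
  minus the initial term on the other.\<close>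

lemma weak_identity:
  "(LINT p:UNIV \<times> {0<..}|lborel. W (fst p / snd p) * \<phi>t p + F (fst p / snd p) * \<phi>x p)
    + (LINT x|lborel. (if x < 0 then wl else wr) * \<phi> (x, 0)) = 0"
proof -
  let ?h = "\<lambda>p. W (fst p / snd p) * \<phi>t p + F (fst p / snd p) * \<phi>x p"
  let ?A = "\<lambda>e::real. UNIV \<times> {e<..} :: (real \<times> real) set"
  have "(\<lambda>k. LINT p|lborel. indicator (?A (1 / real (Suc k))) p * ?h p) \<longlonglongrightarrow>
      (LINT p|lborel. indicator (?A 0) p * ?h p)"
  proof (rule integral_dominated_convergence[where w="\<lambda>p. \<bar>?h p\<bar>"])
    show "integrable lborel (\<lambda>p. \<bar>?h p\<bar>)"
      by (intro integrable_abs integrand_integrable)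
    have "(\<lambda>k. indicator (?A (1 / real (Suc k))) p) \<longlonglongrightarrow> (indicator (?A 0) p :: real)" for p
    proof (cases "snd p > 0")
      case True
      then have "eventually (\<lambda>k. 1 / real (Suc k) < snd p) sequentially"
        using order_tendstoD(2)[OF LIMSEQ_Suc[OF lim_1_over_n]] by auto
      then show ?thesis
        by (intro tendsto_eventually) (auto elim!: eventually_mono simp: indicator_def mem_Times_iff True)
    next
      case False
      have "\<not> 1 / real (Suc k) < snd p" for k
        using False by (smt (verit) divide_pos_pos of_nat_0_less_iff zero_less_Suc)
      with False show ?thesis
        by (auto simp: indicator_def mem_Times_iff)
    qed
    then show "AE p in lborel. (\<lambda>k. indicator (?A (1 / real (Suc k))) p * ?h p) \<longlonglongrightarrow>
        indicator (?A 0) p * ?h p"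
      by (intro AE_I2 tendsto_mult tendsto_const)
    have [measurable]: "?h \<in> borel_measurable lborel"
      using integrand_integrable by (rule borel_measurable_integrable)
    have meas: "(\<lambda>p. indicator (?A e) p * ?h p) \<in> borel_measurable lborel" for e
      by measurable
    show "(\<lambda>p. indicator (?A 0) p * ?h p) \<in> borel_measurable lborel"
      "\<And>k. (\<lambda>p. indicator (?A (1 / real (Suc k))) p * ?h p) \<in> borel_measurable lborel"
      by (rule meas)+
    show "AE p in lborel. norm (indicator (?A (1 / real (Suc k))) p * ?h p) \<le> \<bar>?h p\<bar>" for k
      by (intro AE_I2) (simp add: indicator_def)
  qed
  moreover have "(\<lambda>k. LINT p|lborel. indicator (?A (1 / real (Suc k))) p * ?h p) \<longlonglongrightarrow>
      - (LINT x|lborel. (if x < 0 then wl else wr) * \<phi> (x, 0))"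
    using tendsto_minus[OF initial_trace] by (simp add: truncated_integral del: of_nat_Suc)
  ultimately have "(LINT p|lborel. indicator (?A 0) p * ?h p) =
      - (LINT x|lborel. (if x < 0 then wl else wr) * \<phi> (x, 0))"
    by (rule LIMSEQ_unique)
  then show ?thesis
    by (simp add: set_lebesgue_integral_def)
qed

end

section \<open>The weak conservation law for a self-similar pair\<close>

lemma set_integrable_compact_bounded:
  fixes f :: "'a::euclidean_space \<Rightarrow> real"
  assumes "compact K" and [measurable]: "A \<in> sets borel" "f \<in> borel_measurable borel"
    and bnd: "\<And>x. \<bar>f x\<bar> \<le> C"
  shows "set_integrable lborel (K \<inter> A) f"
  unfolding set_integrable_def
proof (rule integrableI_bounded_set[where A=K and B=C])
  have [measurable]: "K \<in> sets borel" using assms(1) by (simp add: borel_compact)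
  show "K \<in> sets lborel" "(\<lambda>x. indicator (K \<inter> A) x *\<^sub>R f x) \<in> borel_measurable lborel"
    by measurable
  show "emeasure lborel K < \<infinity>"
    using emeasure_bounded_finite[OF compact_imp_bounded[OF assms(1)]] .
  show "AE x in lborel. x \<in> K \<longrightarrow> norm (indicator (K \<inter> A) x *\<^sub>R f x) \<le> C"
    using bnd order_trans[OF abs_ge_zero bnd] by (auto simp: indicator_def)
qed auto

lemma weak_conservation_law_self_similar:
  fixes W F :: "real \<Rightarrow> real"
  assumes [measurable]: "W \<in> borel_measurable borel" "F \<in> borel_measurable borel"
    and bnd: "\<And>\<xi>. \<bar>W \<xi>\<bar> \<le> C" "\<And>\<xi>. \<bar>F \<xi>\<bar> \<le> C"
    and "finite S"
    and "continuous_on UNIV (\<lambda>\<xi>. F \<xi> - \<xi> * W \<xi>)"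
    and "\<And>\<xi>. \<xi> \<notin> S \<Longrightarrow> ((\<lambda>\<xi>. F \<xi> - \<xi> * W \<xi>) has_real_derivative - W \<xi>) (at \<xi>)"
    and "\<And>\<xi>. \<xi> < a \<Longrightarrow> W \<xi> = wl" "\<And>\<xi>. \<xi> > b \<Longrightarrow> W \<xi> = wr"
  shows "weak_conservation_law (\<lambda>p. W (fst p / snd p)) (\<lambda>p. F (fst p / snd p))
    (\<lambda>x. if x < 0 then wl else wr)"
  unfolding weak_conservation_law_def
proof (intro conjI allI impI)
  fix K :: "(real \<times> real) set" assume K: "compact K"
  have m: "(\<lambda>p. W (fst p / snd p)) \<in> borel_measurable (borel :: (real \<times> real) measure)"
    "(\<lambda>p. F (fst p / snd p)) \<in> borel_measurable (borel :: (real \<times> real) measure)"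
    by (rule measurable_compose[OF ratio_measurable assms(1)] measurable_compose[OF ratio_measurable assms(2)])+
  show "set_integrable lborel (K \<inter> UNIV \<times> {0<..}) (\<lambda>p. W (fst p / snd p))"
    using bnd(1) by (rule set_integrable_compact_bounded[OF K upper_measurable m(1)])
  show "set_integrable lborel (K \<inter> UNIV \<times> {0<..}) (\<lambda>p. F (fst p / snd p))"
    using bnd(2) by (rule set_integrable_compact_bounded[OF K upper_measurable m(2)])
next
  fix \<phi> \<phi>x \<phi>t assume t: "test_function \<phi> \<phi>x \<phi>t"
  obtain R where "R > 0"
    "\<And>x t. R \<le> \<bar>x\<bar> \<or> R \<le> \<bar>t\<bar> \<Longrightarrow> \<phi> (x, t) = 0 \<and> \<phi>x (x, t) = 0 \<and> \<phi>t (x, t) = 0"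
    by (rule test_function_support[OF t]) (rule that)
  from weak_identity[OF assms t this]
  show "(LINT p:UNIV \<times> {0<..}|lborel. W (fst p / snd p) * \<phi>t p + F (fst p / snd p) * \<phi>x p)
    + (LINT x|lborel. (if x < 0 then wl else wr) * \<phi> (x, 0)) = 0" .
qed

section \<open>Self-similar profiles\<close>

text \<open>The quantity f - \<xi> w is the flux through the ray x = \<xi> t. Its continuity is the
  Rankine-Hugoniot condition at a jump, and where \<open>V\<close> is smooth its derivative - w says
  f' = \<xi> w'. In this form \<open>w\<close> itself may jump.\<close>

definition balanced :: "(state \<Rightarrow> real) \<Rightarrow> (state \<Rightarrow> real) \<Rightarrow> (real \<Rightarrow> state) \<Rightarrow> bool" where
  "balanced w f V \<longleftrightarrow> (\<exists>S. finite S \<and>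
     continuous_on UNIV (\<lambda>\<xi>. f (V \<xi>) - \<xi> * w (V \<xi>)) \<and>
     (\<forall>\<xi>. \<xi> \<notin> S \<longrightarrow> ((\<lambda>\<xi>. f (V \<xi>) - \<xi> * w (V \<xi>)) has_real_derivative - w (V \<xi>)) (at \<xi>)))"

text \<open>The two profiles both equal \<open>m\<close> on (b, a), so the glued one coincides with
  \<open>V1\<close> on \<open>{..<a}\<close> and with \<open>V2\<close> on \<open>{b<..}\<close>.
  These open sets cover the line, and continuity and differentiability are local.\<close>

lemma balanced_glue:
  assumes 1: "balanced w f V1" and 2: "balanced w f V2" and "b < c" "c < a"
    and m: "\<And>\<xi>. \<xi> > b \<Longrightarrow> V1 \<xi> = m" "\<And>\<xi>. \<xi> < a \<Longrightarrow> V2 \<xi> = m"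
  shows "balanced w f (\<lambda>\<xi>. if \<xi> \<le> c then V1 \<xi> else V2 \<xi>)" (is "balanced w f ?V")
proof -
  let ?G = "\<lambda>V \<xi>. f (V \<xi>) - \<xi> * w (V \<xi>)"
  have V1: "?V \<xi> = V1 \<xi>" if "\<xi> \<in> {..<a}" for \<xi>
    using m that assms(3,4) by auto
  have V2: "?V \<xi> = V2 \<xi>" if "\<xi> \<in> {b<..}" for \<xi>
    using m that assms(3,4) by auto
  obtain S1 where S1: "finite S1" "continuous_on UNIV (?G V1)"
    "\<And>\<xi>. \<xi> \<notin> S1 \<Longrightarrow> (?G V1 has_real_derivative - w (V1 \<xi>)) (at \<xi>)"
    using 1 unfolding balanced_def by blast
  obtain S2 where S2: "finite S2" "continuous_on UNIV (?G V2)"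
    "\<And>\<xi>. \<xi> \<notin> S2 \<Longrightarrow> (?G V2 has_real_derivative - w (V2 \<xi>)) (at \<xi>)"
    using 2 unfolding balanced_def by blast
  have cover: "{..<a} \<union> {b<..} = (UNIV :: real set)"
    using assms(3,4) by auto
  show ?thesis
    unfolding balanced_def
  proof (intro exI[of _ "S1 \<union> S2"] conjI allI impI)
    have "continuous_on {..<a} (?G ?V)"
      using continuous_on_subset[OF S1(2), of "{..<a}"]
      by (rule continuous_on_eq) (use V1 in auto)
    moreover have "continuous_on {b<..} (?G ?V)"
      using continuous_on_subset[OF S2(2), of "{b<..}"]
      by (rule continuous_on_eq) (use V2 in auto)
    ultimately have "continuous_on ({..<a} \<union> {b<..}) (?G ?V)"
      by (intro continuous_on_open_Un) auto
    then show "continuous_on UNIV (?G ?V)"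
      by (simp only: cover)
    fix \<xi> assume \<xi>: "\<xi> \<notin> S1 \<union> S2"
    have "\<xi> \<in> {..<a} \<or> \<xi> \<in> {b<..}"
      using cover by blast
    then show "(?G ?V has_real_derivative - w (?V \<xi>)) (at \<xi>)"
    proof
      assume in1: "\<xi> \<in> {..<a}"
      have "(?G V1 has_real_derivative - w (V1 \<xi>)) (at \<xi>)" using S1(3) \<xi> by auto
      then have "(?G ?V has_real_derivative - w (V1 \<xi>)) (at \<xi>)"
        by (rule has_field_derivative_transform_within_open[where S="{..<a}"])
           (use in1 V1 in auto)
      then show ?thesis by (simp only: V1[OF in1])
    next
      assume in2: "\<xi> \<in> {b<..}"
      have "(?G V2 has_real_derivative - w (V2 \<xi>)) (at \<xi>)" using S2(3) \<xi> by auto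
      then have "(?G ?V has_real_derivative - w (V2 \<xi>)) (at \<xi>)"
        by (rule has_field_derivative_transform_within_open[where S="{b<..}"])
           (use in2 V2 in auto)
      then show ?thesis by (simp only: V2[OF in2])
    qed
  qed (use S1(1) S2(1) in auto)
qed

text \<open>Both branches of f - \<xi> w are affine in \<xi> with the right slope, and
  \<open>RH\<close> says that they meet at \<xi> = \<sigma>.\<close>

lemma balanced_step:
  assumes RH: "f l - \<sigma> * w l = f r - \<sigma> * w r"
  shows "balanced w f (\<lambda>\<xi>. if \<xi> \<le> \<sigma> then l else r)" (is "balanced w f ?V")
  unfolding balanced_def
proof (intro exI[of _ "{\<sigma>}"] conjI allI impI)
  let ?G = "\<lambda>\<xi>. f (?V \<xi>) - \<xi> * w (?V \<xi>)"
  have "continuous_on ({..\<sigma>} \<union> {\<sigma>..}) ?G"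
  proof (rule continuous_on_closed_Un)
    show "continuous_on {..\<sigma>} ?G"
      by (rule continuous_on_eq[where f="\<lambda>\<xi>. f l - \<xi> * w l"]) (auto intro!: continuous_intros)
    show "continuous_on {\<sigma>..} ?G"
      by (rule continuous_on_eq[where f="\<lambda>\<xi>. f r - \<xi> * w r"])
         (use RH in \<open>auto intro!: continuous_intros\<close>)
  qed auto
  moreover have "{..\<sigma>} \<union> {\<sigma>..} = UNIV" by auto
  ultimately show "continuous_on UNIV ?G" by simp
  fix \<xi> assume "\<xi> \<notin> {\<sigma>}"
  then consider "\<xi> < \<sigma>" | "\<xi> > \<sigma>" by fastforce
  then show "(?G has_real_derivative - w (?V \<xi>)) (at \<xi>)"
  proof cases
    case 1
    have "((\<lambda>\<xi>. f l - \<xi> * w l) has_real_derivative - w l) (at \<xi>)"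
      by (auto intro!: derivative_eq_intros)
    then have "(?G has_real_derivative - w l) (at \<xi>)"
      by (rule has_field_derivative_transform_within_open[where S="{..<\<sigma>}"]) (use 1 in auto)
    then show ?thesis using 1 by simp
  next
    case 2
    have "((\<lambda>\<xi>. f r - \<xi> * w r) has_real_derivative - w r) (at \<xi>)"
      by (auto intro!: derivative_eq_intros)
    then have "(?G has_real_derivative - w r) (at \<xi>)"
      by (rule has_field_derivative_transform_within_open[where S="{\<sigma><..}"]) (use 2 in auto)
    then show ?thesis using 2 by simp
  qed
qed auto

section \<open>Profiles for the gas equations and their composition\<close>

locale chaplygin =
  fixes n \<alpha> A B :: real
  assumes n_ge: "1 \<le> n" and alpha_pos: "0 < \<alpha>" and alpha_le: "\<alpha> \<le> 1"
    and A_pos: "A > 0" and B_pos: "B > 0"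
begin

abbreviation "p \<equiv> pressure n \<alpha> A B"
abbreviation "c \<equiv> sound_speed n \<alpha> A B"
abbreviation "\<Phi> \<equiv> shock_fun n \<alpha> A B"

abbreviation "mom q \<equiv> fst q * snd q"
abbreviation "mom_flux q \<equiv> fst q * (snd q)\<^sup>2 + p (fst q)"

text \<open>The compact set \<open>K\<close> keeps the profile away from vacuum: it yields both
  positivity of the density and, by continuity on \<open>K\<close>, bounds for every conserved
  quantity and flux. The case \<open>a = b\<close> is a shock.\<close>

definition profile :: "state \<Rightarrow> state \<Rightarrow> real \<Rightarrow> real \<Rightarrow> (real \<Rightarrow> state) \<Rightarrow> bool" where
  "profile l r a b V \<longleftrightarrow> a \<le> b \<and> (\<forall>\<xi><a. V \<xi> = l) \<and> (\<forall>\<xi>>b. V \<xi> = r) \<and>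
     V \<in> borel_measurable borel \<and>
     (\<exists>K. compact K \<and> K \<subseteq> {q. fst q > 0} \<and> range V \<subseteq> K) \<and>
     balanced fst mom V \<and> balanced mom mom_flux V"

lemma profile_glue:
  assumes 1: "profile l m a1 b1 V1" and 2: "profile m r a2 b2 V2" and "b1 < d" "d < a2"
  shows "profile l r a1 b2 (\<lambda>\<xi>. if \<xi> \<le> d then V1 \<xi> else V2 \<xi>)"
proof -
  obtain K1 K2 where K: "compact K1" "K1 \<subseteq> {q. fst q > 0}" "range V1 \<subseteq> K1"
    "compact K2" "K2 \<subseteq> {q. fst q > 0}" "range V2 \<subseteq> K2"
    using 1 2 unfolding profile_def by blast
  have [measurable]: "V1 \<in> borel_measurable borel" "V2 \<in> borel_measurable borel"
    using 1 2 by (auto simp: profile_def)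
  have m: "\<And>\<xi>. \<xi> > b1 \<Longrightarrow> V1 \<xi> = m" "\<And>\<xi>. \<xi> < a2 \<Longrightarrow> V2 \<xi> = m"
    using 1 2 by (auto simp: profile_def)
  have ord: "a1 \<le> b1" "a2 \<le> b2" and out: "\<And>\<xi>. \<xi> < a1 \<Longrightarrow> V1 \<xi> = l" "\<And>\<xi>. \<xi> > b2 \<Longrightarrow> V2 \<xi> = r"
    using 1 2 by (auto simp: profile_def)
  show ?thesis
    unfolding profile_def
  proof (intro conjI exI[of _ "K1 \<union> K2"])
    show "(\<lambda>\<xi>. if \<xi> \<le> d then V1 \<xi> else V2 \<xi>) \<in> borel_measurable borel"
      by measurable
    show "balanced fst mom (\<lambda>\<xi>. if \<xi> \<le> d then V1 \<xi> else V2 \<xi>)"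
      "balanced mom mom_flux (\<lambda>\<xi>. if \<xi> \<le> d then V1 \<xi> else V2 \<xi>)"
      using 1 2 by (auto intro!: balanced_glue[where m=m] m assms(3,4) simp: profile_def)
    have "V1 \<xi> \<in> K1" "V2 \<xi> \<in> K2" for \<xi>
      using K by auto
    then show "range (\<lambda>\<xi>. if \<xi> \<le> d then V1 \<xi> else V2 \<xi>) \<subseteq> K1 \<union> K2"
      by auto
    show "compact (K1 \<union> K2)" "K1 \<union> K2 \<subseteq> {q. fst q > 0}"
      using K by auto
  qed (use ord out m assms(3,4) in auto)
qed

lemma pressure_continuous:
  "continuous_on T f \<Longrightarrow> (\<And>z. z \<in> T \<Longrightarrow> f z > 0) \<Longrightarrow> continuous_on T (\<lambda>z. p (f z))"
  unfolding pressure_def by (intro continuous_intros) fastforce+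

lemma pressure_measurable:
  "f \<in> borel_measurable M \<Longrightarrow> (\<lambda>z. p (f z)) \<in> borel_measurable M"
  unfolding pressure_def
  by (intro borel_measurable_diff borel_measurable_times powr_real_measurable) auto

text \<open>Both equations are instances of one scalar law: mass has density \<open>fst\<close> and
  flux \<open>mom\<close>, momentum has density \<open>mom\<close> and flux \<open>mom_flux\<close>.
  Each of these is continuous on the compact set containing the range, hence bounded along the
  profile.\<close>

lemma profile_self_similar_solution:
  assumes V: "profile l r a b V"
  shows "self_similar_solution n \<alpha> A B l r V"
proof -
  obtain K where K: "compact K" "K \<subseteq> {q. fst q > 0}" "range V \<subseteq> K"
    using V unfolding profile_def by blast
  have V_meas: "V \<in> borel_measurable borel"
    using V by (auto simp: profile_def)
  have comp_meas: "(\<lambda>\<xi>. fst (V \<xi>)) \<in> borel_measurable borel" "(\<lambda>\<xi>. snd (V \<xi>)) \<in> borel_measurable borel"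
    by (rule measurable_compose[OF V_meas], intro borel_measurable_continuous_onI continuous_intros)+
  have meas_flux: "(\<lambda>\<xi>. mom_flux (V \<xi>)) \<in> borel_measurable borel"
    by (intro borel_measurable_add borel_measurable_times borel_measurable_power
        pressure_measurable comp_meas)
  have bound: "\<exists>C. \<forall>\<xi>. \<bar>g (V \<xi>)\<bar> \<le> C" if "continuous_on K g" for g :: "state \<Rightarrow> real"
  proof -
    have "bounded (g ` K)"
      by (intro compact_imp_bounded compact_continuous_image that K(1))
    then show ?thesis
      using K(3) unfolding bounded_iff by fastforce
  qed
  have law: "weak_conservation_law (\<lambda>p. w (V (fst p / snd p))) (\<lambda>p. f (V (fst p / snd p)))
      (\<lambda>x. if x < 0 then w l else w r)"
    if w: "continuous_on K w" and f: "continuous_on K f" and bal: "balanced w f V"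
      and meas: "(\<lambda>\<xi>. w (V \<xi>)) \<in> borel_measurable borel" "(\<lambda>\<xi>. f (V \<xi>)) \<in> borel_measurable borel"
    for w f
  proof -
    obtain C1 C2 where C: "\<And>\<xi>. \<bar>w (V \<xi>)\<bar> \<le> C1" "\<And>\<xi>. \<bar>f (V \<xi>)\<bar> \<le> C2"
      using bound[OF w] bound[OF f] by blast
    obtain S where S: "finite S" "continuous_on UNIV (\<lambda>\<xi>. f (V \<xi>) - \<xi> * w (V \<xi>))"
     "\<And>\<xi>. \<xi> \<notin> S \<Longrightarrow> ((\<lambda>\<xi>. f (V \<xi>) - \<xi> * w (V \<xi>)) has_real_derivative - w (V \<xi>)) (at \<xi>)"
      using bal unfolding balanced_def by blast
    have C': "\<bar>w (V \<xi>)\<bar> \<le> max C1 C2" "\<bar>f (V \<xi>)\<bar> \<le> max C1 C2" for \<xi>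
      using C[of \<xi>] by auto
    have out: "w (V \<xi>) = w l" if "\<xi> < a" for \<xi>
      using V that by (simp add: profile_def)
    have out': "w (V \<xi>) = w r" if "\<xi> > b" for \<xi>
      using V that by (simp add: profile_def)
    show ?thesis
      by (rule weak_conservation_law_self_similar[where W="\<lambda>\<xi>. w (V \<xi>)" and F="\<lambda>\<xi>. f (V \<xi>)",
            OF meas C' S out out'])
  qed
  have pos: "fst (V \<xi>) > 0" for \<xi>
    using K(2,3) by auto
  have "weak_conservation_law (\<lambda>p. fst (V (fst p / snd p))) (\<lambda>p. mom (V (fst p / snd p)))
      (\<lambda>x. if x < 0 then fst l else fst r)"
    using V by (intro law[where w=fst and f="\<lambda>q. mom q"] continuous_on_fst continuous_on_snd
        continuous_on_mult continuous_on_id borel_measurable_times comp_meas) (simp add: profile_def)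
  moreover have "weak_conservation_law (\<lambda>p. mom (V (fst p / snd p))) (\<lambda>p. mom_flux (V (fst p / snd p)))
      (\<lambda>x. if x < 0 then mom l else mom r)"
    using V K(2) by (intro law[where w="\<lambda>q. mom q" and f="\<lambda>q. mom_flux q"] continuous_on_fst continuous_on_snd
        continuous_on_mult continuous_on_add continuous_on_power continuous_on_id pressure_continuous meas_flux
        borel_measurable_times comp_meas) (auto simp: profile_def)
  moreover have "(\<lambda>x::real. fst (if x < 0 then l else r)) = (\<lambda>x. if x < 0 then fst l else fst r)"
    "(\<lambda>x::real. mom (if x < 0 then l else r)) = (\<lambda>x. if x < 0 then mom l else mom r)"
    by auto
  ultimately show ?thesis
    unfolding self_similar_solution_def riemann_weak_solution_def Let_def
    using pos by (simp add: case_prod_unfold)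
qed

text \<open>The wave predicate is demanded of every \<open>V\<close> that agrees with
  \<open>V0\<close> on [a, b], so that it survives gluing \<open>V0\<close> to another wave.\<close>

definition wave_profile where
  "wave_profile W l r a b \<longleftrightarrow>
     (\<exists>V0. profile l r a b V0 \<and> (\<forall>V. (\<forall>\<xi>\<in>{a..b}. V \<xi> = V0 \<xi>) \<longrightarrow> W V a b l r))"

text \<open>The strict inequality leaves a gap between the waves in which both profiles equal
  \<open>m\<close>; they are glued at its midpoint.\<close>

lemma wave_profiles_compose:
  assumes 1: "wave_profile W1 l m a1 b1" and 2: "wave_profile W2 m r a2 b2" and "b1 < a2"
  shows "\<exists>V. self_similar_solution n \<alpha> A B l r V \<and> wave_followed_by W1 W2 V l r"
proof -
  obtain V1 V2 where V1: "profile l m a1 b1 V1"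
      "\<And>V. (\<And>\<xi>. \<xi> \<in> {a1..b1} \<Longrightarrow> V \<xi> = V1 \<xi>) \<Longrightarrow> W1 V a1 b1 l m"
    and V2: "profile m r a2 b2 V2"
      "\<And>V. (\<And>\<xi>. \<xi> \<in> {a2..b2} \<Longrightarrow> V \<xi> = V2 \<xi>) \<Longrightarrow> W2 V a2 b2 m r"
    using 1 2 unfolding wave_profile_def by metis
  define d where "d = (b1 + a2) / 2"
  have d: "b1 < d" "d < a2"
    using assms(3) by (auto simp: d_def)
  let ?V = "\<lambda>\<xi>. if \<xi> \<le> d then V1 \<xi> else V2 \<xi>"
  have "profile l r a1 b2 ?V"
    by (rule profile_glue[OF V1(1) V2(1) d])
  moreover have "W1 ?V a1 b1 l m" "W2 ?V a2 b2 m r"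
    using d by (auto intro!: V1(2) V2(2))
  moreover have "\<forall>\<xi><a1. ?V \<xi> = l" "\<forall>\<xi>\<in>{b1<..<a2}. ?V \<xi> = m" "\<forall>\<xi>>b2. ?V \<xi> = r"
    using V1(1) V2(1) d by (auto simp: profile_def)
  ultimately have "wave_followed_by W1 W2 ?V l r"
    unfolding wave_followed_by_def using assms(3) by blast
  with profile_self_similar_solution[OF \<open>profile l r a1 b2 ?V\<close>] show ?thesis
    by blast
qed

end

section \<open>Rarefaction waves\<close>

context chaplygin
begin

section \<open>Sound speed, pressure and genuine nonlinearity\<close>

lemma sound_speed_square:
  assumes "\<rho> > 0"
  shows "(c \<rho>)\<^sup>2 = A * n * \<rho> powr (n - 1) + \<alpha> * B * \<rho> powr (- \<alpha> - 1)" and "c \<rho> > 0"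
proof -
  have "A * n * \<rho> powr (n - 1) > 0" "\<alpha> * B * \<rho> powr (- \<alpha> - 1) > 0"
    using assms n_ge alpha_pos A_pos B_pos by (auto intro!: mult_pos_pos)
  then show "(c \<rho>)\<^sup>2 = A * n * \<rho> powr (n - 1) + \<alpha> * B * \<rho> powr (- \<alpha> - 1)" "c \<rho> > 0"
    unfolding sound_speed_def by auto
qed

lemma pressure_deriv:
  assumes "\<rho> > 0"
  shows "(p has_real_derivative (c \<rho>)\<^sup>2) (at \<rho>)"
proof -
  have "((\<lambda>\<rho>. A * \<rho> powr n - B * \<rho> powr (- \<alpha>)) has_real_derivative
      A * (n * \<rho> powr (n - 1)) - B * (- \<alpha> * \<rho> powr (- \<alpha> - 1))) (at \<rho>)"
    using assms by (intro DERIV_diff DERIV_cmult has_real_derivative_powr)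
  then show ?thesis
    unfolding sound_speed_square(1)[OF assms] pressure_def[abs_def] by (simp add: algebra_simps)
qed

lemma pressure_strict_mono:
  assumes "0 < x" "x < y"
  shows "p x < p y"
proof (rule DERIV_pos_imp_increasing[OF \<open>x < y\<close>])
  fix z assume "x \<le> z"
  then have "z > 0" using assms by simp
  then show "\<exists>d. (p has_real_derivative d) (at z) \<and> d > 0"
    using pressure_deriv sound_speed_square(2) by (meson zero_less_power)
qed

text \<open>The derivative of c, written as (c^2)' / (2 c).\<close>

definition sound_speed_slope :: "real \<Rightarrow> real" where
  "sound_speed_slope \<rho> =
    (A * n * ((n - 1) * \<rho> powr (n - 1 - 1)) + \<alpha> * B * ((- \<alpha> - 1) * \<rho> powr (- \<alpha> - 1 - 1))) / (2 * c \<rho>)"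

lemma sound_speed_deriv:
  assumes "\<rho> > 0"
  shows "(c has_real_derivative sound_speed_slope \<rho>) (at \<rho>)"
proof -
  let ?g = "\<lambda>\<rho>. A * n * \<rho> powr (n - 1) + \<alpha> * B * \<rho> powr (- \<alpha> - 1)"
  let ?g' = "A * n * ((n - 1) * \<rho> powr (n - 1 - 1)) + \<alpha> * B * ((- \<alpha> - 1) * \<rho> powr (- \<alpha> - 1 - 1))"
  have pos: "?g \<rho> > 0"
    using sound_speed_square[OF assms] by (metis zero_less_power)
  have "(?g has_real_derivative ?g') (at \<rho>)"
    using assms by (intro DERIV_add DERIV_cmult has_real_derivative_powr)
  from DERIV_chain2[OF DERIV_real_sqrt[OF pos] this]
  show ?thesis
    unfolding sound_speed_slope_def sound_speed_def[abs_def] by (simp add: field_simps)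
qed

text \<open>Multiplication by 2 c \<rho> turns the sum into 2 c^2 + \<rho> (c^2)'. The two powers of
  \<rho> in it have coefficients A n (n + 1) > 0 and \<alpha> B (1 - \<alpha>) \<ge> 0, the latter
  because \<alpha> \<le> 1. This is the genuine nonlinearity of both families.\<close>

lemma rarefaction_slope_pos:
  assumes "\<rho> > 0"
  shows "c \<rho> / \<rho> + sound_speed_slope \<rho> > 0"
proof -
  let ?N = "A * n * ((n - 1) * \<rho> powr (n - 1 - 1)) + \<alpha> * B * ((- \<alpha> - 1) * \<rho> powr (- \<alpha> - 1 - 1))"
  have c: "c \<rho> > 0" by (rule sound_speed_square(2)[OF assms])
  have powr_eq: "\<rho> * \<rho> powr (e - 1) = \<rho> powr e" for e
    using assms by (simp add: powr_mult_base)
  have "2 * (c \<rho>)\<^sup>2 + \<rho> * ?N =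
      2 * (A * n * \<rho> powr (n - 1) + \<alpha> * B * \<rho> powr (- \<alpha> - 1)) +
      (A * n * (n - 1) * (\<rho> * \<rho> powr (n - 1 - 1)) + \<alpha> * B * (- \<alpha> - 1) * (\<rho> * \<rho> powr (- \<alpha> - 1 - 1)))"
    unfolding sound_speed_square(1)[OF assms] by (simp add: distrib_left mult.assoc mult.left_commute)
  also have "\<dots> = A * n * (n + 1) * \<rho> powr (n - 1) + \<alpha> * B * (1 - \<alpha>) * \<rho> powr (- \<alpha> - 1)"
    unfolding powr_eq by (simp add: algebra_simps)
  also have "\<dots> > 0"
    using assms n_ge alpha_pos alpha_le A_pos B_pos by (intro add_pos_nonneg) auto
  finally have "(2 * (c \<rho>)\<^sup>2 + \<rho> * ?N) / (2 * c \<rho> * \<rho>) > 0"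
    using c assms by simp
  also have "(2 * (c \<rho>)\<^sup>2 + \<rho> * ?N) / (2 * c \<rho> * \<rho>) = c \<rho> / \<rho> + ?N / (2 * c \<rho>)"
    using c assms by (simp add: field_simps power2_eq_square)
  finally show ?thesis
    unfolding sound_speed_slope_def .
qed

text \<open>The base point 1 only fixes an additive constant; differences of \<open>J\<close> give
  the oriented integral between any two positive densities.\<close>

definition J :: "real \<Rightarrow> real" where
  "J \<rho> = rarefaction_integral n \<alpha> A B 1 \<rho>"

text \<open>One antiderivative \<open>F\<close> of c s / s on the whole of (0, \<infinity>) serves
  all end points, and \<open>J\<close> equals \<open>F - F 1\<close> there.\<close>

lemma
  shows rarefaction_integral_eq: "0 < x \<Longrightarrow> 0 < y \<Longrightarrow> rarefaction_integral n \<alpha> A B x y = J y - J x"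
    and J_deriv: "0 < x \<Longrightarrow> (J has_real_derivative c x / x) (at x)"
proof -
  have cont: "isCont (\<lambda>x. c x / x) x" if "x > 0" for x
    using that by (intro continuous_intros DERIV_isCont[OF sound_speed_deriv]) auto
  have "\<exists>F. \<forall>x :: real. 0 < ereal x \<longrightarrow> ereal x < \<infinity> \<longrightarrow> (F has_vector_derivative c x / x) (at x)"
    by (rule einterval_antiderivative) (use cont in auto)
  then obtain F where F: "\<And>x. x > 0 \<Longrightarrow> (F has_vector_derivative c x / x) (at x)"
    by auto
  have FTC: "rarefaction_integral n \<alpha> A B x y = F y - F x" if "0 < x" "0 < y" for x y
    unfolding rarefaction_integral_def
  proof (rule interval_integral_FTC_finite)
    show "continuous_on {min x y..max x y} (\<lambda>x. c x / x)"
      using that by (intro continuous_at_imp_continuous_on ballI cont) auto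
    show "(F has_vector_derivative c z / z) (at z within {min x y..max x y})"
      if "min x y \<le> z" "z \<le> max x y" for z
      using F[of z] \<open>0 < x\<close> \<open>0 < y\<close> that by (auto intro: has_vector_derivative_at_within)
  qed
  then show "0 < x \<Longrightarrow> 0 < y \<Longrightarrow> rarefaction_integral n \<alpha> A B x y = J y - J x" for x y
    by (simp add: J_def)
  show "0 < x \<Longrightarrow> (J has_real_derivative c x / x) (at x)" for x
  proof -
    assume x: "0 < x"
    then have "((\<lambda>x. F x - F 1) has_real_derivative c x / x) (at x)"
      using F by (auto simp: has_real_derivative_iff_has_vector_derivative intro!: derivative_eq_intros)
    then show "(J has_real_derivative c x / x) (at x)"
      by (rule has_field_derivative_transform_within_open[where S="{0<..}"])
         (use x FTC in \<open>auto simp: J_def\<close>)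
  qed
qed

lemma J_continuous: "T \<subseteq> {0<..} \<Longrightarrow> continuous_on T J"
  by (intro continuous_at_imp_continuous_on ballI DERIV_isCont[OF J_deriv]) auto

text \<open>Along a 2-rarefaction u + c is a constant plus this function, along a 1-rarefaction u -
  c is a constant minus it. One monotone function thus governs the characteristic speed in both
  families.\<close>

definition rarefaction_speed :: "real \<Rightarrow> real" where
  "rarefaction_speed \<rho> = J \<rho> + c \<rho>"

lemma rarefaction_speed_deriv:
  "\<rho> > 0 \<Longrightarrow> (rarefaction_speed has_real_derivative c \<rho> / \<rho> + sound_speed_slope \<rho>) (at \<rho>)"
  unfolding rarefaction_speed_def[abs_def] by (intro DERIV_add J_deriv sound_speed_deriv)

lemma rarefaction_speed_strict_mono:
  assumes "0 < x" "x < y"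
  shows "rarefaction_speed x < rarefaction_speed y"
proof (rule DERIV_pos_imp_increasing[OF \<open>x < y\<close>])
  fix z assume "x \<le> z"
  then have "z > 0" using assms by simp
  then show "\<exists>d. (rarefaction_speed has_real_derivative d) (at z) \<and> d > 0"
    using rarefaction_speed_deriv rarefaction_slope_pos by blast
qed

lemma rarefaction_speed_less_iff:
  assumes "0 < x" "0 < y"
  shows "rarefaction_speed x < rarefaction_speed y \<longleftrightarrow> x < y"
  using rarefaction_speed_strict_mono[of x y] rarefaction_speed_strict_mono[of y x] assms
  by (cases x y rule: linorder_cases) auto

text \<open>A continuous strictly increasing map of [x, y] has a continuous inverse, differentiable
  because the slope is positive. The inverse recovers the density inside a fan from the similarity
  variable.\<close>

lemma rarefaction_speed_inverse:
  assumes "0 < x" "x < y"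
  obtains \<kappa> where "continuous_on {rarefaction_speed x..rarefaction_speed y} \<kappa>"
    "\<And>z. z \<in> {rarefaction_speed x..rarefaction_speed y} \<Longrightarrow> x \<le> \<kappa> z \<and> \<kappa> z \<le> y \<and> rarefaction_speed (\<kappa> z) = z"
    "\<And>z. z \<in> {rarefaction_speed x<..<rarefaction_speed y} \<Longrightarrow>
       (\<kappa> has_real_derivative inverse (c (\<kappa> z) / \<kappa> z + sound_speed_slope (\<kappa> z))) (at z)"
proof -
  let ?k = "rarefaction_speed" and ?I = "{rarefaction_speed x..rarefaction_speed y}"
  let ?g = "inv_into {x..y} ?k"
  have cont: "continuous_on {x..y} ?k"
    using assms by (intro continuous_at_imp_continuous_on ballI DERIV_isCont[OF rarefaction_speed_deriv]) auto
  have inj: "inj_on ?k {x..y}"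
  proof (rule linorder_inj_onI')
    fix i j assume "i \<in> {x..y}" "i < j"
    then show "?k i \<noteq> ?k j"
      using rarefaction_speed_strict_mono[of i j] assms by auto
  qed
  have img: "?k ` {x..y} = ?I"
  proof
    show "?k ` {x..y} \<subseteq> ?I"
      using assms rarefaction_speed_less_iff by (auto simp: not_less[symmetric])
    show "?I \<subseteq> ?k ` {x..y}"
      using IVT'[of ?k x _ y] assms cont by fastforce
  qed
  have g: "x \<le> ?g z \<and> ?g z \<le> y \<and> ?k (?g z) = z" if "z \<in> ?I" for z
    using inv_into_into[of z ?k "{x..y}"] f_inv_into_f[of z ?k "{x..y}"] that img by auto
  have g_cont: "continuous_on ?I ?g"
    using continuous_on_inv[OF cont, of ?g] inv_into_f_f[OF inj] img by auto
  have "(?g has_real_derivative inverse (c (?g z) / ?g z + sound_speed_slope (?g z))) (at z)"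
    if z: "z \<in> {?k x<..<?k y}" for z
  proof (rule DERIV_inverse_function[where f="?k" and a="?k x" and b="?k y"])
    have pos: "?g z > 0" using g[of z] z assms by auto
    show "(?k has_real_derivative c (?g z) / ?g z + sound_speed_slope (?g z)) (at (?g z))"
      by (rule rarefaction_speed_deriv[OF pos])
    show "c (?g z) / ?g z + sound_speed_slope (?g z) \<noteq> 0"
      using rarefaction_slope_pos[OF pos] by simp
    show "isCont ?g z"
      using continuous_on_interior[OF g_cont, of z] z by simp
  qed (use z g in auto)
  with g_cont g that show ?thesis by blast
qed

text \<open>In terms of u - \<xi> = - s c the mass quantity is \<rho> (u - \<xi>), and \<rho> u' = s
  c \<rho>' cancels \<rho>' (u - \<xi>). The momentum quantity is u times the mass quantity plus p;
  there \<rho> u' (u - \<xi>) = - c^2 \<rho>' cancels the derivative of the pressure.\<close>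

lemma rarefaction_balance_deriv:
  fixes \<rho> u :: "real \<Rightarrow> real"
  assumes \<rho>: "(\<rho> has_real_derivative d) (at \<xi>)"
    and u: "(u has_real_derivative s * (c (\<rho> \<xi>) / \<rho> \<xi>) * d) (at \<xi>)"
    and pos: "\<rho> \<xi> > 0" and s: "s\<^sup>2 = 1" and char: "\<xi> = u \<xi> + s * c (\<rho> \<xi>)"
  shows "((\<lambda>\<xi>. \<rho> \<xi> * u \<xi> - \<xi> * \<rho> \<xi>) has_real_derivative - \<rho> \<xi>) (at \<xi>)"
    and "((\<lambda>\<xi>. (\<rho> \<xi> * (u \<xi>)\<^sup>2 + p (\<rho> \<xi>)) - \<xi> * (\<rho> \<xi> * u \<xi>)) has_real_derivative - (\<rho> \<xi> * u \<xi>)) (at \<xi>)"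
proof -
  let ?u' = "s * (c (\<rho> \<xi>) / \<rho> \<xi>) * d"
  have 1: "\<rho> \<xi> * ?u' = s * c (\<rho> \<xi>) * d"
    using pos by simp
  have 2: "u \<xi> - \<xi> = - (s * c (\<rho> \<xi>))"
    using char by simp
  have "((\<lambda>\<xi>. \<rho> \<xi> * (u \<xi> - \<xi>)) has_real_derivative d * (u \<xi> - \<xi>) + (?u' - 1) * \<rho> \<xi>) (at \<xi>)"
    by (intro DERIV_mult DERIV_diff \<rho> u DERIV_ident)
  also have "d * (u \<xi> - \<xi>) + (?u' - 1) * \<rho> \<xi> = - \<rho> \<xi>"
    unfolding 2 using 1 by (simp add: algebra_simps)
  finally have mass: "((\<lambda>\<xi>. \<rho> \<xi> * (u \<xi> - \<xi>)) has_real_derivative - \<rho> \<xi>) (at \<xi>)" .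
  then show "((\<lambda>\<xi>. \<rho> \<xi> * u \<xi> - \<xi> * \<rho> \<xi>) has_real_derivative - \<rho> \<xi>) (at \<xi>)"
    by (simp add: algebra_simps)
  have "((\<lambda>\<xi>. u \<xi> * (\<rho> \<xi> * (u \<xi> - \<xi>)) + p (\<rho> \<xi>)) has_real_derivative
      (?u' * (\<rho> \<xi> * (u \<xi> - \<xi>)) + (- \<rho> \<xi>) * u \<xi>) + (c (\<rho> \<xi>))\<^sup>2 * d) (at \<xi>)"
    by (intro DERIV_add DERIV_mult mass u DERIV_chain2[where f=p and g=\<rho>, OF pressure_deriv[OF pos] \<rho>])
  also have "?u' * (\<rho> \<xi> * (u \<xi> - \<xi>)) = (\<rho> \<xi> * ?u') * (u \<xi> - \<xi>)"
    by simp
  also have "\<dots> = - (s\<^sup>2 * (c (\<rho> \<xi>))\<^sup>2 * d)"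
    unfolding 1 2 by (simp add: power2_eq_square)
  also have "- (s\<^sup>2 * (c (\<rho> \<xi>))\<^sup>2 * d) + (- \<rho> \<xi>) * u \<xi> + (c (\<rho> \<xi>))\<^sup>2 * d = - (\<rho> \<xi> * u \<xi>)"
    unfolding s by simp
  finally show "((\<lambda>\<xi>. (\<rho> \<xi> * (u \<xi>)\<^sup>2 + p (\<rho> \<xi>)) - \<xi> * (\<rho> \<xi> * u \<xi>)) has_real_derivative - (\<rho> \<xi> * u \<xi>)) (at \<xi>)"
    by (simp add: algebra_simps power2_eq_square)
qed

text \<open>The sign \<open>s\<close> is \<open>-1\<close> for the first and \<open>1\<close> for the second family; clamping the
  similarity variable to \<open>[a, b]\<close> makes the profile continuous on the whole line.\<close>

lemma rarefaction_profile:
  assumes s: "s = -1 \<or> s = 1" and pos: "0 < \<rho>l" "0 < \<rho>r" and ord: "s * \<rho>l < s * \<rho>r"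
    and ur: "ur = ul + s * (J \<rho>r - J \<rho>l)"
    and a: "a = ul + s * c \<rho>l" and b: "b = ur + s * c \<rho>r"
  obtains V where "profile (\<rho>l, ul) (\<rho>r, ur) a b V" "a < b" "V a = (\<rho>l, ul)" "V b = (\<rho>r, ur)"
    "\<And>\<xi>. \<xi> \<in> {a<..<b} \<Longrightarrow> 0 < fst (V \<xi>) \<and> s * \<rho>l < s * fst (V \<xi>) \<and>
       snd (V \<xi>) = ul + s * (J (fst (V \<xi>)) - J \<rho>l) \<and> \<xi> = snd (V \<xi>) + s * c (fst (V \<xi>))"
proof -
  let ?k = rarefaction_speed
  define x y where "x = min \<rho>l \<rho>r" and "y = max \<rho>l \<rho>r"
  \<comment> \<open>Eliminating u from u = ul + s (J \<rho> - J \<rho>l) and \<xi> = u + s c \<rho>,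
    with s^2 = 1, gives \<open>rarefaction_speed \<rho> = \<eta> \<xi>\<close>; the density in the
    fan is therefore \<kappa> (\<eta> \<xi>).\<close>
  define \<eta> where "\<eta> \<xi> = s * (\<xi> - ul) + J \<rho>l" for \<xi>
  have xy: "0 < x" "x < y"
    using pos ord s by (auto simp: x_def y_def)
  obtain \<kappa> where \<kappa>: "continuous_on {?k x..?k y} \<kappa>"
    "\<And>z. z \<in> {?k x..?k y} \<Longrightarrow> x \<le> \<kappa> z \<and> \<kappa> z \<le> y \<and> ?k (\<kappa> z) = z"
    "\<And>z. z \<in> {?k x<..<?k y} \<Longrightarrow>
       (\<kappa> has_real_derivative inverse (c (\<kappa> z) / \<kappa> z + sound_speed_slope (\<kappa> z))) (at z)"
    using rarefaction_speed_inverse[OF xy] by metis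
  have ss: "s * s = 1" "s\<^sup>2 = 1" using s by (auto simp: power2_eq_square)
  have \<eta>ab: "\<eta> a = ?k \<rho>l" "\<eta> b = ?k \<rho>r"
    using s by (elim disjE; simp add: \<eta>_def a b ur rarefaction_speed_def)+
  have ab_k: "s * (b - a) = ?k \<rho>r - ?k \<rho>l"
    unfolding \<eta>ab[symmetric] by (simp add: \<eta>_def algebra_simps)
  have k_mono: "?k \<rho>l < ?k \<rho>r \<longleftrightarrow> \<rho>l < \<rho>r" "?k \<rho>r < ?k \<rho>l \<longleftrightarrow> \<rho>r < \<rho>l"
    using rarefaction_speed_less_iff pos by auto
  have ab: "a < b"
    using s ab_k k_mono ord by (elim disjE; simp)
  have \<eta>_in: "\<eta> \<xi> \<in> {?k x..?k y}" if "\<xi> \<in> {a..b}" for \<xi>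
    using s
  proof
    assume s1: "s = -1"
    then have "x = \<rho>r" "y = \<rho>l" using ord by (auto simp: x_def y_def)
    then show ?thesis using that \<eta>ab s1 by (auto simp: \<eta>_def)
  next
    assume s1: "s = 1"
    then have "x = \<rho>l" "y = \<rho>r" using ord by (auto simp: x_def y_def)
    then show ?thesis using that \<eta>ab s1 by (auto simp: \<eta>_def)
  qed
  have \<eta>_in': "\<eta> \<xi> \<in> {?k x<..<?k y}" if "\<xi> \<in> {a<..<b}" for \<xi>
    using s
  proof
    assume s1: "s = -1"
    then have "x = \<rho>r" "y = \<rho>l" using ord by (auto simp: x_def y_def)
    then show ?thesis using that \<eta>ab s1 by (auto simp: \<eta>_def)
  next
    assume s1: "s = 1"
    then have "x = \<rho>l" "y = \<rho>r" using ord by (auto simp: x_def y_def)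
    then show ?thesis using that \<eta>ab s1 by (auto simp: \<eta>_def)
  qed
  have inj: "z = w" if "?k z = ?k w" "0 < z" "0 < w" for z w
    using rarefaction_speed_less_iff that by (metis less_irrefl linorder_neqE_linordered_idom)
  define R where "R \<xi> = \<kappa> (\<eta> \<xi>)" for \<xi>
  \<comment> \<open>With this choice the characteristic relation holds by definition, and membership
    in the wave curve is what remains to be derived, in \<open>U_eq\<close>.\<close>
  define U where "U \<xi> = \<xi> - s * c (R \<xi>)" for \<xi>
  have R: "0 < R \<xi>" "?k (R \<xi>) = \<eta> \<xi>" if "\<xi> \<in> {a..b}" for \<xi>
    using \<kappa>(2)[OF \<eta>_in[OF that]] xy by (auto simp: R_def)
  have R_ab: "R a = \<rho>l" "R b = \<rho>r"
    using inj[of "R a" \<rho>l] inj[of "R b" \<rho>r] R[of a] R[of b] ab pos \<eta>ab by simp_all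
  have U_ab: "U a = ul" "U b = ur"
    unfolding U_def R_ab by (simp_all add: a b)
  have R_ord: "s * \<rho>l < s * R \<xi>" if "\<xi> \<in> {a<..<b}" for \<xi>
  proof -
    have "s * (\<xi> - a) = ?k (R \<xi>) - ?k \<rho>l"
      using R(2)[of \<xi>] that unfolding \<eta>ab(1)[symmetric] by (simp add: \<eta>_def algebra_simps)
    moreover have "R \<xi> > 0" using R(1)[of \<xi>] that by simp
    ultimately show ?thesis
      using s that rarefaction_speed_less_iff[of "R \<xi>" \<rho>l] rarefaction_speed_less_iff[of \<rho>l "R \<xi>"]
        pos by (elim disjE; simp)
  qed
  have U_eq: "U \<xi> = ul + s * (J (R \<xi>) - J \<rho>l)" if "\<xi> \<in> {a..b}" for \<xi>
  proof -
    have "J (R \<xi>) + c (R \<xi>) = s * (\<xi> - ul) + J \<rho>l"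
      using R(2)[OF that] by (simp add: rarefaction_speed_def \<eta>_def)
    then have "J (R \<xi>) - J \<rho>l = s * (\<xi> - ul) - c (R \<xi>)" by simp
    then show ?thesis using s by (elim disjE; simp add: U_def)
  qed
  have R_cont: "continuous_on {a..b} R"
    unfolding R_def using \<eta>_in
    by (intro continuous_on_compose2[OF \<kappa>(1)]) (auto simp: \<eta>_def intro!: continuous_intros)
  have c_cont: "continuous_on {0<..} c"
    by (intro continuous_at_imp_continuous_on ballI DERIV_isCont[OF sound_speed_deriv]) auto
  have U_cont: "continuous_on {a..b} U"
    unfolding U_def using R(1)
    by (intro continuous_intros continuous_on_compose2[OF c_cont R_cont]) auto
  define clamp where "clamp \<xi> = max a (min b \<xi>)" for \<xi>
  have clamp: "clamp \<xi> \<in> {a..b}" for \<xi> using ab by (auto simp: clamp_def)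
  have clamp_id: "clamp \<xi> = \<xi>" if "\<xi> \<in> {a..b}" for \<xi> using that by (auto simp: clamp_def)
  have clamp_cont: "continuous_on UNIV clamp"
    unfolding clamp_def by (intro continuous_intros)
  define V where "V \<xi> = (R (clamp \<xi>), U (clamp \<xi>))" for \<xi>
  have V_in: "V \<xi> = (R \<xi>, U \<xi>)" if "\<xi> \<in> {a..b}" for \<xi>
    by (simp add: V_def clamp_id[OF that])
  have V_left: "V \<xi> = (\<rho>l, ul)" if "\<xi> \<le> a" for \<xi>
    using that ab by (simp add: V_def clamp_def R_ab U_ab)
  have V_right: "V \<xi> = (\<rho>r, ur)" if "\<xi> \<ge> b" for \<xi>
    using that ab by (simp add: V_def clamp_def R_ab U_ab)
  have RU_cont: "continuous_on {a..b} (\<lambda>\<xi>. (R \<xi>, U \<xi>))"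
    by (intro continuous_intros R_cont U_cont)
  have V_cont: "continuous_on UNIV V"
    unfolding V_def using clamp by (intro continuous_on_compose2[OF RU_cont clamp_cont]) auto
  have V_pos: "fst (V \<xi>) > 0" for \<xi>
    using R(1)[OF clamp] by (simp add: V_def)
  \<comment> \<open>The profile is constant outside [a, b] and its only kinks are at the edges of
    the fan, so {a, b} serves as exceptional set.\<close>
  have bal: "balanced w f V"
    if cont: "continuous_on UNIV (\<lambda>\<xi>. f (V \<xi>) - \<xi> * w (V \<xi>))"
      and deriv: "\<And>\<xi>. \<xi> \<in> {a<..<b} \<Longrightarrow>
        ((\<lambda>\<xi>. f (R \<xi>, U \<xi>) - \<xi> * w (R \<xi>, U \<xi>)) has_real_derivative - w (R \<xi>, U \<xi>)) (at \<xi>)"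
    for w f
    unfolding balanced_def
  proof (intro exI[of _ "{a, b}"] conjI allI impI cont)
    let ?G = "\<lambda>\<xi>. f (V \<xi>) - \<xi> * w (V \<xi>)"
    fix \<xi> assume "\<xi> \<notin> {a, b}"
    then consider "\<xi> < a" | "\<xi> \<in> {a<..<b}" | "\<xi> > b" by fastforce
    then show "(?G has_real_derivative - w (V \<xi>)) (at \<xi>)"
    proof cases
      case 1
      have "((\<lambda>\<xi>. f (\<rho>l, ul) - \<xi> * w (\<rho>l, ul)) has_real_derivative - w (\<rho>l, ul)) (at \<xi>)"
        by (auto intro!: derivative_eq_intros)
      then have "(?G has_real_derivative - w (\<rho>l, ul)) (at \<xi>)"
        by (rule has_field_derivative_transform_within_open[where S="{..<a}"])
           (use 1 V_left in auto)
      then show ?thesis using 1 V_left by simp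
    next
      case 2
      have "(?G has_real_derivative - w (R \<xi>, U \<xi>)) (at \<xi>)"
        using deriv[OF 2]
        by (rule has_field_derivative_transform_within_open[where S="{a<..<b}"])
           (use 2 V_in in auto)
      then show ?thesis using 2 V_in by simp
    next
      case 3
      have "((\<lambda>\<xi>. f (\<rho>r, ur) - \<xi> * w (\<rho>r, ur)) has_real_derivative - w (\<rho>r, ur)) (at \<xi>)"
        by (auto intro!: derivative_eq_intros)
      then have "(?G has_real_derivative - w (\<rho>r, ur)) (at \<xi>)"
        by (rule has_field_derivative_transform_within_open[where S="{b<..}"])
           (use 3 V_right in auto)
      then show ?thesis using 3 V_right by simp
    qed
  qed auto
  have deriv: "((\<lambda>\<xi>. R \<xi> * U \<xi> - \<xi> * R \<xi>) has_real_derivative - R \<xi>) (at \<xi>)"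
    "((\<lambda>\<xi>. (R \<xi> * (U \<xi>)\<^sup>2 + p (R \<xi>)) - \<xi> * (R \<xi> * U \<xi>)) has_real_derivative - (R \<xi> * U \<xi>)) (at \<xi>)"
    if \<xi>: "\<xi> \<in> {a<..<b}" for \<xi>
  proof -
    have Rpos: "R \<xi> > 0" using R(1)[of \<xi>] \<xi> by auto
    define d where "d = inverse (c (R \<xi>) / R \<xi> + sound_speed_slope (R \<xi>)) * s"
    have "(\<eta> has_real_derivative s) (at \<xi>)"
      unfolding \<eta>_def by (auto intro!: derivative_eq_intros)
    from DERIV_chain2[where f=\<kappa> and g=\<eta>, OF \<kappa>(3)[OF \<eta>_in'[OF \<xi>]] this]
    have Rd: "(R has_real_derivative d) (at \<xi>)"
      by (simp add: R_def[abs_def] d_def)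
    have d: "(c (R \<xi>) / R \<xi> + sound_speed_slope (R \<xi>)) * d = s"
      using rarefaction_slope_pos[OF Rpos] by (simp add: d_def)
    \<comment> \<open>Differentiating U = \<xi> - s c(R) gives 1 - s c'(R) R'; the relation (c / R +
      c'(R)) R' = s and s^2 = 1 turn this into s (c / R) R', the form required by
      \<open>rarefaction_balance_deriv\<close>.\<close>
    have "s * (c (R \<xi>) / R \<xi>) * d + s * (sound_speed_slope (R \<xi>) * d) =
        s * ((c (R \<xi>) / R \<xi> + sound_speed_slope (R \<xi>)) * d)"
      by (simp only: distrib_left distrib_right mult.assoc)
    also have "\<dots> = s * s"
      by (simp only: d)
    finally have "s * (c (R \<xi>) / R \<xi>) * d + s * (sound_speed_slope (R \<xi>) * d) = s * s" .
    then have eq: "1 - s * (sound_speed_slope (R \<xi>) * d) = s * (c (R \<xi>) / R \<xi>) * d"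
      unfolding ss(1) by simp
    have "(U has_real_derivative 1 - s * (sound_speed_slope (R \<xi>) * d)) (at \<xi>)"
      unfolding U_def[abs_def]
      by (intro DERIV_diff DERIV_ident DERIV_cmult DERIV_chain2[where f=c and g=R, OF sound_speed_deriv[OF Rpos] Rd])
    then have Ud: "(U has_real_derivative s * (c (R \<xi>) / R \<xi>) * d) (at \<xi>)"
      unfolding eq .
    show "((\<lambda>\<xi>. R \<xi> * U \<xi> - \<xi> * R \<xi>) has_real_derivative - R \<xi>) (at \<xi>)"
      "((\<lambda>\<xi>. (R \<xi> * (U \<xi>)\<^sup>2 + p (R \<xi>)) - \<xi> * (R \<xi> * U \<xi>)) has_real_derivative - (R \<xi> * U \<xi>)) (at \<xi>)"
      by (rule rarefaction_balance_deriv[OF Rd Ud Rpos ss(2)], simp add: U_def)+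
  qed
  have "profile (\<rho>l, ul) (\<rho>r, ur) a b V"
    unfolding profile_def
  proof (intro conjI exI[of _ "(\<lambda>\<xi>. (R \<xi>, U \<xi>)) ` {a..b}"])
    show "V \<in> borel_measurable borel"
      by (rule borel_measurable_continuous_onI[OF V_cont])
    show "compact ((\<lambda>\<xi>. (R \<xi>, U \<xi>)) ` {a..b})"
      by (intro compact_continuous_image RU_cont) auto
    show "range V \<subseteq> (\<lambda>\<xi>. (R \<xi>, U \<xi>)) ` {a..b}"
      using clamp by (auto simp: V_def)
    show "balanced fst mom V"
      by (rule bal) (use deriv(1) in \<open>auto intro!: continuous_intros V_cont\<close>)
    show "balanced mom mom_flux V"
    proof (rule bal)
      show "continuous_on UNIV (\<lambda>\<xi>. mom_flux (V \<xi>) - \<xi> * mom (V \<xi>))"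
        by (intro continuous_intros V_cont pressure_continuous V_pos)
    qed (use deriv(2) in auto)
  qed (use ab V_left V_right R(1) in auto)
  then show ?thesis
  proof (rule that)
    fix \<xi> assume "\<xi> \<in> {a<..<b}"
    then show "0 < fst (V \<xi>) \<and> s * \<rho>l < s * fst (V \<xi>) \<and>
       snd (V \<xi>) = ul + s * (J (fst (V \<xi>)) - J \<rho>l) \<and> \<xi> = snd (V \<xi>) + s * c (fst (V \<xi>))"
      using R(1)[of \<xi>] R_ord[of \<xi>] U_eq[of \<xi>] V_in[of \<xi>] by (auto simp: U_def)
  qed (use ab V_left V_right in auto)
qed

end

section \<open>Shocks and intermediate states\<close>

context chaplygin
begin

section \<open>The two rarefaction waves\<close>

lemma R1_wave_profile:
  assumes "0 < \<rho>r" "\<rho>r < \<rho>l" and ur: "ur = ul + (J \<rho>l - J \<rho>r)"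
  shows "wave_profile (R1_wave n \<alpha> A B) (\<rho>l, ul) (\<rho>r, ur) (ul - c \<rho>l) (ur - c \<rho>r)"
proof -
  obtain V where V: "profile (\<rho>l, ul) (\<rho>r, ur) (ul - c \<rho>l) (ur - c \<rho>r) V"
    "ul - c \<rho>l < ur - c \<rho>r" "V (ul - c \<rho>l) = (\<rho>l, ul)" "V (ur - c \<rho>r) = (\<rho>r, ur)"
    "\<And>\<xi>. \<xi> \<in> {ul - c \<rho>l<..<ur - c \<rho>r} \<Longrightarrow> 0 < fst (V \<xi>) \<and> - 1 * \<rho>l < - 1 * fst (V \<xi>) \<and>
       snd (V \<xi>) = ul + - 1 * (J (fst (V \<xi>)) - J \<rho>l) \<and> \<xi> = snd (V \<xi>) + - 1 * c (fst (V \<xi>))"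
    using assms by (rule_tac rarefaction_profile[where s="-1" and \<rho>l=\<rho>l and \<rho>r=\<rho>r and ul=ul and ur=ur
          and a="ul - c \<rho>l" and b="ur - c \<rho>r"]) auto
  show ?thesis
    unfolding wave_profile_def R1_wave_def
  proof (intro exI[of _ V] conjI allI impI ballI V(1,2))
    show "(\<rho>r, ur) \<in> R1_curve n \<alpha> A B (\<rho>l, ul)"
      using assms by (simp add: R1_curve_def rarefaction_integral_eq)
    fix V' assume eq: "\<forall>\<xi>\<in>{ul - c \<rho>l..ur - c \<rho>r}. V' \<xi> = V \<xi>"
    then show "V' (ul - c \<rho>l) = (\<rho>l, ul)" "V' (ur - c \<rho>r) = (\<rho>r, ur)"
      using V(2-4) by auto
    fix \<xi> assume \<xi>: "\<xi> \<in> {ul - c \<rho>l<..<ur - c \<rho>r}"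
    then have "V' \<xi> = V \<xi>" using eq by auto
    then show "V' \<xi> \<in> R1_curve n \<alpha> A B (\<rho>l, ul)" "\<xi> = char_speed1 n \<alpha> A B (V' \<xi>)"
      using V(5)[OF \<xi>] assms by (auto simp: R1_curve_def rarefaction_integral_eq char_speed1_def case_prod_beta)
  qed (auto simp: char_speed1_def)
qed

lemma R2_wave_profile:
  assumes "0 < \<rho>l" "\<rho>l < \<rho>r" and ur: "ur = ul + (J \<rho>r - J \<rho>l)"
  shows "wave_profile (R2_wave n \<alpha> A B) (\<rho>l, ul) (\<rho>r, ur) (ul + c \<rho>l) (ur + c \<rho>r)"
proof -
  obtain V where V: "profile (\<rho>l, ul) (\<rho>r, ur) (ul + c \<rho>l) (ur + c \<rho>r) V"
    "ul + c \<rho>l < ur + c \<rho>r" "V (ul + c \<rho>l) = (\<rho>l, ul)" "V (ur + c \<rho>r) = (\<rho>r, ur)"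
    "\<And>\<xi>. \<xi> \<in> {ul + c \<rho>l<..<ur + c \<rho>r} \<Longrightarrow> 0 < fst (V \<xi>) \<and> 1 * \<rho>l < 1 * fst (V \<xi>) \<and>
       snd (V \<xi>) = ul + 1 * (J (fst (V \<xi>)) - J \<rho>l) \<and> \<xi> = snd (V \<xi>) + 1 * c (fst (V \<xi>))"
    using assms by (rule_tac rarefaction_profile[where s=1 and \<rho>l=\<rho>l and \<rho>r=\<rho>r and ul=ul and ur=ur
          and a="ul + c \<rho>l" and b="ur + c \<rho>r"]) auto
  show ?thesis
    unfolding wave_profile_def R2_wave_def
  proof (intro exI[of _ V] conjI allI impI ballI V(1,2))
    show "(\<rho>r, ur) \<in> R2_curve n \<alpha> A B (\<rho>l, ul)"
      using assms by (simp add: R2_curve_def rarefaction_integral_eq)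
    fix V' assume eq: "\<forall>\<xi>\<in>{ul + c \<rho>l..ur + c \<rho>r}. V' \<xi> = V \<xi>"
    then show "V' (ul + c \<rho>l) = (\<rho>l, ul)" "V' (ur + c \<rho>r) = (\<rho>r, ur)"
      using V(2-4) by auto
    fix \<xi> assume \<xi>: "\<xi> \<in> {ul + c \<rho>l<..<ur + c \<rho>r}"
    then have "V' \<xi> = V \<xi>" using eq by auto
    then show "V' \<xi> \<in> R2_curve n \<alpha> A B (\<rho>l, ul)" "\<xi> = char_speed2 n \<alpha> A B (V' \<xi>)"
      using V(5)[OF \<xi>] assms by (auto simp: R2_curve_def rarefaction_integral_eq char_speed2_def case_prod_beta)
  qed (auto simp: char_speed2_def)
qed

section \<open>The shock jump and the Rankine-Hugoniot conditions\<close>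

lemma shock_fun_eq:
  assumes "x > 0" "y > 0"
  shows "\<Phi> x y = sqrt ((x - y) / (x * y) * (p x - p y))"
  using assms by (simp add: shock_fun_def pressure_def powr_minus_divide algebra_simps)

text \<open>The pressure is increasing, so x - y and p x - p y have the same sign; the square root
  in \<Phi> is therefore a genuine one.\<close>

lemma pressure_product_nonneg:
  assumes "x > 0" "y > 0"
  shows "(x - y) / (x * y) * (p x - p y) \<ge> 0"
  using assms pressure_strict_mono[of x y] pressure_strict_mono[of y x]
  by (cases x y rule: linorder_cases) (auto simp: zero_le_mult_iff zero_le_divide_iff divide_le_0_iff)

lemma shock_fun_square:
  assumes "x > 0" "y > 0"
  shows "x * y * (\<Phi> x y)\<^sup>2 = (x - y) * (p x - p y)"
  using assms pressure_product_nonneg[OF assms] by (simp add: shock_fun_eq)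

lemma shock_fun_nonneg: "x > 0 \<Longrightarrow> y > 0 \<Longrightarrow> \<Phi> x y \<ge> 0"
  by (simp only: shock_fun_eq real_sqrt_ge_0_iff pressure_product_nonneg)

lemma shock_fun_pos:
  assumes "x > 0" "y > 0" "x \<noteq> y"
  shows "\<Phi> x y > 0"
proof -
  have "(x - y) * (p x - p y) \<noteq> 0"
    using assms pressure_strict_mono[of x y] pressure_strict_mono[of y x]
    by (cases x y rule: linorder_cases) auto
  then have "\<Phi> x y \<noteq> 0"
    using shock_fun_square[OF assms(1,2)] by auto
  then show ?thesis
    using shock_fun_nonneg[OF assms(1,2)] by simp
qed

lemma shock_fun_commute: "\<Phi> x y = \<Phi> y x"
proof -
  have "(x - y) / (x * y) = - ((y - x) / (y * x))"
    by (simp add: minus_divide_left mult.commute)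
  moreover have "A * (x powr n - y powr n) - B * (1 / x powr \<alpha> - 1 / y powr \<alpha>) =
      - (A * (y powr n - x powr n) - B * (1 / y powr \<alpha> - 1 / x powr \<alpha>))"
    by (simp only: algebra_simps)
  ultimately show ?thesis
    unfolding shock_fun_def by (simp only: minus_mult_minus)
qed

lemma shock_fun_continuous:
  assumes "T \<subseteq> {0<..}" "y > 0"
  shows "continuous_on T (\<lambda>x. \<Phi> x y)"
proof -
  have "continuous_on T (\<lambda>x. sqrt ((x - y) / (x * y) * (p x - p y)))"
    using assms by (intro continuous_intros pressure_continuous) auto
  then show ?thesis
    by (rule continuous_on_eq) (use assms in \<open>auto simp: shock_fun_eq\<close>)
qed

text \<open>The shock speed is the mass condition by definition. The square of the velocity jump, as
  prescribed by \<Phi>, makes \<rho>r - \<rho>l times the momentum flux jump equal to the square of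
  the mass flux jump, and cancelling \<rho>r - \<rho>l leaves the momentum condition.\<close>

lemma shock_profile:
  assumes pos: "\<rho>l > 0" "\<rho>r > 0" and ne: "\<rho>l \<noteq> \<rho>r" and ur: "ur - ul = - \<Phi> \<rho>r \<rho>l"
    and \<sigma>: "\<sigma> = shock_speed (\<rho>l, ul) (\<rho>r, ur)"
  shows "profile (\<rho>l, ul) (\<rho>r, ur) \<sigma> \<sigma> (\<lambda>\<xi>. if \<xi> \<le> \<sigma> then (\<rho>l, ul) else (\<rho>r, ur))"
proof -
  have mass: "\<sigma> * (\<rho>r - \<rho>l) = \<rho>r * ur - \<rho>l * ul"
    using ne by (simp add: \<sigma> shock_speed_def)
  have "(ur - ul)\<^sup>2 = (\<Phi> \<rho>r \<rho>l)\<^sup>2"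
    by (simp add: ur)
  then have jump: "\<rho>r * \<rho>l * (ur - ul)\<^sup>2 = (\<rho>r - \<rho>l) * (p \<rho>r - p \<rho>l)"
    using shock_fun_square[OF pos(2,1)] by simp
  have "(\<rho>r - \<rho>l) * ((\<rho>r * ur\<^sup>2 + p \<rho>r) - (\<rho>l * ul\<^sup>2 + p \<rho>l)) =
      (\<rho>r - \<rho>l) * (\<rho>r * ur\<^sup>2 - \<rho>l * ul\<^sup>2) + \<rho>r * \<rho>l * (ur - ul)\<^sup>2"
    unfolding jump by (simp add: algebra_simps)
  \<comment> \<open>The term with the squared velocity jump is exactly what completes this
    square.\<close>
  also have "\<dots> = (\<rho>r * ur - \<rho>l * ul) * (\<rho>r * ur - \<rho>l * ul)"
    by (simp add: algebra_simps power2_eq_square)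
  also have "\<dots> = (\<rho>r - \<rho>l) * (\<sigma> * (\<rho>r * ur - \<rho>l * ul))"
    unfolding mass[symmetric] by (simp add: algebra_simps)
  finally have momentum: "(\<rho>r * ur\<^sup>2 + p \<rho>r) - (\<rho>l * ul\<^sup>2 + p \<rho>l) = \<sigma> * (\<rho>r * ur - \<rho>l * ul)"
    using ne by simp
  show ?thesis
    unfolding profile_def
  proof (intro conjI exI[of _ "{(\<rho>l, ul), (\<rho>r, ur)}"] balanced_step)
    show "(\<lambda>\<xi>. if \<xi> \<le> \<sigma> then (\<rho>l, ul) else (\<rho>r, ur)) \<in> borel_measurable borel"
      by measurable
  qed (use pos mass momentum in \<open>auto simp: algebra_simps\<close>)
qed

lemma S1_wave_profile:
  assumes "0 < \<rho>l" "\<rho>l < \<rho>r" and ur: "ur - ul = - \<Phi> \<rho>r \<rho>l"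
  shows "wave_profile (S1_wave n \<alpha> A B) (\<rho>l, ul) (\<rho>r, ur)
    (shock_speed (\<rho>l, ul) (\<rho>r, ur)) (shock_speed (\<rho>l, ul) (\<rho>r, ur))"
  unfolding wave_profile_def
  using assms shock_profile[OF _ _ _ ur refl] by (auto simp: S1_wave_def S1_curve_def)

lemma S2_wave_profile:
  assumes "0 < \<rho>r" "\<rho>r < \<rho>l" and ur: "ur - ul = - \<Phi> \<rho>r \<rho>l"
  shows "wave_profile (S2_wave n \<alpha> A B) (\<rho>l, ul) (\<rho>r, ur)
    (shock_speed (\<rho>l, ul) (\<rho>r, ur)) (shock_speed (\<rho>l, ul) (\<rho>r, ur))"
  unfolding wave_profile_def
  using assms shock_profile[OF _ _ _ ur refl] by (auto simp: S2_wave_def S2_curve_def)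

text \<open>The difference \<sigma> - ur equals \<rho>l (ur - ul) / (\<rho>r - \<rho>l), where ur <
  ul and \<rho>l < \<rho>r. Here \<open>ur\<close> is the intermediate velocity.\<close>

lemma S1_shock_speed_less:
  assumes "0 < \<rho>l" "\<rho>l < \<rho>r" and ur: "ur - ul = - \<Phi> \<rho>r \<rho>l"
  shows "shock_speed (\<rho>l, ul) (\<rho>r, ur) < ur"
proof -
  have "\<rho>l * ur < \<rho>l * ul"
    using shock_fun_pos[of \<rho>r \<rho>l] assms by simp
  then show ?thesis
    using assms by (simp add: shock_speed_def field_simps)
qed

text \<open>The difference \<sigma> - ul equals \<rho>r (ur - ul) / (\<rho>r - \<rho>l), a quotient
  of two negative numbers up to the factor \<rho>r > 0. Here \<open>ul\<close> is the intermediate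
  velocity.\<close>

lemma S2_shock_speed_greater:
  assumes "0 < \<rho>r" "\<rho>r < \<rho>l" and ur: "ur - ul = - \<Phi> \<rho>r \<rho>l"
  shows "ul < shock_speed (\<rho>l, ul) (\<rho>r, ur)"
proof -
  have "\<rho>r * ur < \<rho>r * ul"
    using shock_fun_pos[of \<rho>r \<rho>l] assms by simp
  then show ?thesis
    using assms by (simp add: shock_speed_def field_simps)
qed

text \<open>Since \<open>c s / s\<close> dominates a multiple of \<open>1 / s\<close> near \<open>0\<close>, no vacuum can appear
  between two rarefaction waves.\<close>

lemma J_le_ln:
  assumes "0 < x" "x \<le> 1"
  shows "J x \<le> sqrt (\<alpha> * B) * ln x"
proof -
  let ?K = "sqrt (\<alpha> * B)"
  \<comment> \<open>The difference \<open>J x - ?K * ln x\<close> is nondecreasing on (0, 1], since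
    c^2 \<ge> \<alpha> B there, and it vanishes at 1.\<close>
  have "J 1 - ?K * ln 1 \<ge> J x - ?K * ln x"
  proof (rule DERIV_nonneg_imp_nondecreasing[OF \<open>x \<le> 1\<close>])
    fix z assume z: "x \<le> z" "z \<le> 1"
    then have z0: "z > 0" using assms by simp
    have "1 \<le> z powr (- \<alpha> - 1)"
      using z z0 alpha_pos powr_mono2'[of "- \<alpha> - 1" z 1] by simp
    then have "\<alpha> * B * 1 \<le> \<alpha> * B * z powr (- \<alpha> - 1)"
      using alpha_pos B_pos by (intro mult_left_mono) auto
    also have "\<dots> \<le> A * n * z powr (n - 1) + \<alpha> * B * z powr (- \<alpha> - 1)"
      using A_pos n_ge by simp
    finally have "?K \<le> c z"
      unfolding sound_speed_def by simp
    then have "0 \<le> c z / z - ?K * (1 / z)"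
      using z0 by (simp add: field_simps)
    moreover have "((\<lambda>x. J x - ?K * ln x) has_real_derivative c z / z - ?K * (1 / z)) (at z)"
      using DERIV_diff[OF J_deriv[OF z0] DERIV_cmult[OF DERIV_ln_divide[OF z0], of ?K]] .
    ultimately show "\<exists>d. ((\<lambda>x. J x - ?K * ln x) has_real_derivative d) (at z) \<and> 0 \<le> d"
      by blast
  qed
  moreover have "J 1 = 0"
    using rarefaction_integral_eq[of 1 1] by (simp add: J_def)
  ultimately show ?thesis by simp
qed

lemma J_mono:
  assumes "0 < x" "x \<le> y"
  shows "J x \<le> J y"
proof (rule DERIV_nonneg_imp_nondecreasing[OF \<open>x \<le> y\<close>])
  fix z assume "x \<le> z"
  then have "z > 0" using assms by simp
  then show "\<exists>d. (J has_real_derivative d) (at z) \<and> 0 \<le> d"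
    using J_deriv sound_speed_square(2) by (meson divide_nonneg_nonneg less_imp_le)
qed

lemma J_unbounded_below:
  assumes "y > 0"
  obtains x where "0 < x" "x < y" "J x < M"
proof -
  let ?K = "sqrt (\<alpha> * B)"
  have K: "?K > 0" using alpha_pos B_pos by simp
  \<comment> \<open>The first entry gives x < y, the second makes \<open>J_le_ln\<close> applicable,
    and the third gives \<open>?K * ln x \<le> M - 1\<close>.\<close>
  define x where "x = min (min (y / 2) 1) (exp ((M - 1) / ?K))"
  have x: "0 < x" "x < y" "x \<le> 1" using assms by (auto simp: x_def)
  have "ln x \<le> (M - 1) / ?K"
    using x(1) by (intro iffD2[OF ln_le_cancel_iff[of x "exp ((M - 1) / ?K)"], simplified]) (auto simp: x_def)
  then have "?K * ln x \<le> M - 1"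
    using K by (simp add: field_simps)
  then have "J x < M" using J_le_ln[OF x(1,3)] by simp
  with x that show ?thesis by blast
qed

text \<open>In \<Phi>^2 = (x - y) / (x y) * (p x - p y) the first factor is at least 1 / (2 y) once
  x \<ge> 2 y, and p x \<ge> A x - B for x \<ge> 1 because n \<ge> 1.\<close>

lemma shock_fun_unbounded:
  assumes "y > 0"
  obtains x where "x > y" "x > z" "\<Phi> x y > M"
proof -
  \<comment> \<open>The last entry forces p x - p y \<ge> 2 y (M^2 + 1), hence \<Phi>^2 \<ge> M^2 +
    1.\<close>
  define x where "x = max (max 1 (2 * y)) (max (z + 1) ((B + p y + 2 * y * (M\<^sup>2 + 1)) / A))"
  have x: "x \<ge> 1" "x \<ge> 2 * y" "x > z" "x > y" "x > 0"
    using assms by (auto simp: x_def)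
  have "(B + p y + 2 * y * (M\<^sup>2 + 1)) / A \<le> x"
    by (simp add: x_def)
  then have "B + p y + 2 * y * (M\<^sup>2 + 1) \<le> A * x"
    using A_pos by (simp add: field_simps)
  moreover have "A * x - B \<le> p x"
  proof -
    have "x powr 1 \<le> x powr n" using x n_ge by (intro powr_mono) auto
    then have "A * x \<le> A * x powr n" using x A_pos by simp
    moreover have "x powr (- \<alpha>) \<le> 1"
      using x alpha_pos powr_mono[of "- \<alpha>" 0 x] by simp
    then have "B * x powr (- \<alpha>) \<le> B * 1" using B_pos by (intro mult_left_mono) auto
    ultimately show ?thesis by (simp add: pressure_def)
  qed
  ultimately have dp: "2 * y * (M\<^sup>2 + 1) \<le> p x - p y" by simp
  have "1 / (2 * y) \<le> (x - y) / (x * y)"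
    using x assms by (simp add: field_simps)
  then have "1 / (2 * y) * (2 * y * (M\<^sup>2 + 1)) \<le> (x - y) / (x * y) * (p x - p y)"
    using dp x assms by (intro mult_mono) auto
  then have "M\<^sup>2 + 1 \<le> (x - y) / (x * y) * (p x - p y)"
    using assms by simp
  then have "M\<^sup>2 < (x - y) / (x * y) * (p x - p y)"
    by linarith
  then have "sqrt (M\<^sup>2) < \<Phi> x y"
    unfolding shock_fun_eq[OF x(5) assms] by (rule real_sqrt_less_mono)
  then have "\<Phi> x y > M" by simp
  with x that show ?thesis by blast
qed

section \<open>The intermediate state in each of the four regions\<close>

lemma R1R2_solution:
  assumes pos: "\<rho>m > 0" and r: "(\<rho>p, up) \<in> region_R1R2 n \<alpha> A B (\<rho>m, um)"
  shows "\<exists>V. self_similar_solution n \<alpha> A B (\<rho>m, um) (\<rho>p, up) V \<and>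
    wave_followed_by (R1_wave n \<alpha> A B) (R2_wave n \<alpha> A B) V (\<rho>m, um) (\<rho>p, up)"
proof -
  have pos': "\<rho>p > 0" and gap: "\<bar>J \<rho>p - J \<rho>m\<bar> < up - um"
    using r pos by (auto simp: region_R1R2_def rarefaction_integral_eq)
  define y where "y = min \<rho>m \<rho>p"
  have y: "y > 0" using pos pos' by (simp add: y_def)
  \<comment> \<open>The velocity jump of a 1-rarefaction down to density x followed by a
    2-rarefaction from x up to \<rho>p. At x = y one of the two waves degenerates and the other
    accounts for the whole jump.\<close>
  define g where "g x = (J \<rho>m - J x) + (J \<rho>p - J x)" for x
  \<comment> \<open>The threshold for \<open>J x\<close> is the inequality g x > up - um solved for
    \<open>J x\<close>.\<close>
  obtain x where x: "0 < x" "x < y" "J x < (J \<rho>m + J \<rho>p - (up - um)) / 2"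
    using J_unbounded_below[OF y] by metis
  have "g y = \<bar>J \<rho>p - J \<rho>m\<bar>"
    using pos pos' J_mono by (cases "\<rho>m \<le> \<rho>p") (auto simp: g_def y_def min_def)
  then have gy: "g y < up - um" using gap by simp
  have "\<exists>\<rho>\<ge>x. \<rho> \<le> y \<and> g \<rho> = up - um"
    by (rule IVT2') (use gy x in \<open>auto simp: g_def intro!: continuous_intros J_continuous\<close>)
  then obtain \<rho> where \<rho>: "x \<le> \<rho>" "\<rho> \<le> y" "g \<rho> = up - um" by blast
  then have "\<rho> \<noteq> y" using gy by auto
  with \<rho> x have \<rho>': "0 < \<rho>" "\<rho> < \<rho>m" "\<rho> < \<rho>p" by (auto simp: y_def)
  define u where "u = um + (J \<rho>m - J \<rho>)"
  have "up = u + (J \<rho>p - J \<rho>)" using \<rho>(3) by (simp add: u_def g_def)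
  then show ?thesis
    using \<rho>' sound_speed_square(2)[OF \<rho>'(1)]
    by (intro wave_profiles_compose[OF R1_wave_profile[OF _ _ u_def] R2_wave_profile]) auto
qed

lemma R1S2_solution:
  assumes pos: "\<rho>m > 0" and r: "(\<rho>p, up) \<in> region_R1S2 n \<alpha> A B (\<rho>m, um)"
  shows "\<exists>V. self_similar_solution n \<alpha> A B (\<rho>m, um) (\<rho>p, up) V \<and>
    wave_followed_by (R1_wave n \<alpha> A B) (S2_wave n \<alpha> A B) V (\<rho>m, um) (\<rho>p, up)"
proof -
  have pos': "\<rho>p > 0" "\<rho>p < \<rho>m" and gap: "- \<Phi> \<rho>p \<rho>m < up - um" "up - um < J \<rho>m - J \<rho>p"
    using r pos by (auto simp: region_R1S2_def rarefaction_integral_eq)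
  \<comment> \<open>The velocity jump of a 1-rarefaction to density x followed by a 2-shock to
    \<rho>p: the shock degenerates at x = \<rho>p, the rarefaction at x = \<rho>m, and the region
    bounds up - um strictly between these two values.\<close>
  define g where "g x = (J \<rho>m - J x) - \<Phi> x \<rho>p" for x
  have ends: "g \<rho>p = J \<rho>m - J \<rho>p" "g \<rho>m = - \<Phi> \<rho>p \<rho>m"
    by (simp_all add: g_def shock_fun_commute[of \<rho>m]) (simp add: shock_fun_def)
  have "\<exists>\<rho>\<ge>\<rho>p. \<rho> \<le> \<rho>m \<and> g \<rho> = up - um"
    using pos' gap ends
    by (intro IVT2') (auto simp: g_def intro!: continuous_intros J_continuous shock_fun_continuous)
  then obtain \<rho> where \<rho>: "\<rho>p \<le> \<rho>" "\<rho> \<le> \<rho>m" "g \<rho> = up - um" by blast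
  then have "\<rho> \<noteq> \<rho>p" "\<rho> \<noteq> \<rho>m" using gap ends by auto
  with \<rho> pos' have \<rho>': "0 < \<rho>" "\<rho>p < \<rho>" "\<rho> < \<rho>m" by auto
  define u where "u = um + (J \<rho>m - J \<rho>)"
  have up: "up - u = - \<Phi> \<rho>p \<rho>"
    using \<rho>(3) by (simp add: u_def g_def shock_fun_commute[of \<rho>p])
  have "u - c \<rho> < shock_speed (\<rho>, u) (\<rho>p, up)"
    using S2_shock_speed_greater[OF pos'(1) \<rho>'(2) up] sound_speed_square(2)[OF \<rho>'(1)] by simp
  then show ?thesis
    by (rule wave_profiles_compose[OF R1_wave_profile[OF \<rho>'(1,3) u_def] S2_wave_profile[OF pos'(1) \<rho>'(2) up]])
qed

lemma S1R2_solution: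
  assumes pos: "\<rho>m > 0" and r: "(\<rho>p, up) \<in> region_S1R2 n \<alpha> A B (\<rho>m, um)"
  shows "\<exists>V. self_similar_solution n \<alpha> A B (\<rho>m, um) (\<rho>p, up) V \<and>
    wave_followed_by (S1_wave n \<alpha> A B) (R2_wave n \<alpha> A B) V (\<rho>m, um) (\<rho>p, up)"
proof -
  have pos': "\<rho>m < \<rho>p" and gap: "- \<Phi> \<rho>p \<rho>m < up - um" "up - um < J \<rho>p - J \<rho>m"
    using r pos by (auto simp: region_S1R2_def rarefaction_integral_eq)
  \<comment> \<open>The velocity jump of a 1-shock to density x followed by a 2-rarefaction to
    \<rho>p; now the shock degenerates at x = \<rho>m and the rarefaction at x = \<rho>p.\<close>
  define g where "g x = (J \<rho>p - J x) - \<Phi> x \<rho>m" for x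
  have ends: "g \<rho>m = J \<rho>p - J \<rho>m" "g \<rho>p = - \<Phi> \<rho>p \<rho>m"
    by (simp_all add: g_def) (simp add: shock_fun_def)
  have "\<exists>\<rho>\<ge>\<rho>m. \<rho> \<le> \<rho>p \<and> g \<rho> = up - um"
    using pos pos' gap ends
    by (intro IVT2') (auto simp: g_def intro!: continuous_intros J_continuous shock_fun_continuous)
  then obtain \<rho> where \<rho>: "\<rho>m \<le> \<rho>" "\<rho> \<le> \<rho>p" "g \<rho> = up - um" by blast
  then have "\<rho> \<noteq> \<rho>p" "\<rho> \<noteq> \<rho>m" using gap ends by auto
  with \<rho> pos have \<rho>': "0 < \<rho>" "\<rho>m < \<rho>" "\<rho> < \<rho>p" by auto
  define u where "u = um - \<Phi> \<rho> \<rho>m"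
  have u: "u - um = - \<Phi> \<rho> \<rho>m" by (simp add: u_def)
  have up: "up = u + (J \<rho>p - J \<rho>)"
    using \<rho>(3) by (simp add: u_def g_def)
  have "shock_speed (\<rho>m, um) (\<rho>, u) < u + c \<rho>"
    using S1_shock_speed_less[OF pos \<rho>'(2) u] sound_speed_square(2)[OF \<rho>'(1)] by simp
  then show ?thesis
    by (rule wave_profiles_compose[OF S1_wave_profile[OF pos \<rho>'(2) u] R2_wave_profile[OF \<rho>'(1,3) up]])
qed

lemma S1S2_solution:
  assumes pos: "\<rho>m > 0" and r: "(\<rho>p, up) \<in> region_S1S2 n \<alpha> A B (\<rho>m, um)"
  shows "\<exists>V. self_similar_solution n \<alpha> A B (\<rho>m, um) (\<rho>p, up) V \<and>
    wave_followed_by (S1_wave n \<alpha> A B) (S2_wave n \<alpha> A B) V (\<rho>m, um) (\<rho>p, up)"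
proof -
  have pos': "\<rho>p > 0" and gap: "up - um < - \<Phi> \<rho>p \<rho>m"
    using r by (auto simp: region_S1S2_def)
  define y where "y = max \<rho>m \<rho>p"
  \<comment> \<open>The velocity jump of two shocks with intermediate density x. At x = y one of
    them has zero strength and the other gives - \<Phi> \<rho>p \<rho>m, the boundary value of the
    region.\<close>
  define g where "g x = - \<Phi> x \<rho>m - \<Phi> x \<rho>p" for x
  have "\<Phi> \<rho>m \<rho>m = 0" "\<Phi> \<rho>p \<rho>p = 0" by (simp_all add: shock_fun_def)
  then have gy: "g y = - \<Phi> \<rho>p \<rho>m"
    by (simp add: g_def y_def max_def shock_fun_commute[of \<rho>m \<rho>p])
  \<comment> \<open>Making the first shock strong enough suffices, because the second one only
    lowers \<open>g\<close> further.\<close>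
  obtain x where x: "x > \<rho>m" "x > \<rho>p" "\<Phi> x \<rho>m > um - up"
    using shock_fun_unbounded[OF pos] by metis
  have gx: "g x \<le> up - um"
    using shock_fun_nonneg[of x \<rho>p] pos pos' x by (simp add: g_def)
  have "\<exists>\<rho>\<ge>y. \<rho> \<le> x \<and> g \<rho> = up - um"
  proof (rule IVT2')
    have "{y..x} \<subseteq> {0<..}" using pos by (auto simp: y_def)
    then show "continuous_on {y..x} g"
      unfolding g_def using pos pos' by (intro continuous_intros shock_fun_continuous)
  qed (use gx gy gap x in \<open>auto simp: y_def\<close>)
  then obtain \<rho> where \<rho>: "y \<le> \<rho>" "\<rho> \<le> x" "g \<rho> = up - um" by blast
  then have "\<rho> \<noteq> y" using gap gy by auto
  with \<rho>(1) have \<rho>': "\<rho>m < \<rho>" "\<rho>p < \<rho>" by (auto simp: y_def)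
  define u where "u = um - \<Phi> \<rho> \<rho>m"
  have u: "u - um = - \<Phi> \<rho> \<rho>m" by (simp add: u_def)
  have up: "up - u = - \<Phi> \<rho>p \<rho>"
    using \<rho>(3) by (simp add: u_def g_def shock_fun_commute[of \<rho>p])
  have "shock_speed (\<rho>m, um) (\<rho>, u) < shock_speed (\<rho>, u) (\<rho>p, up)"
    using S1_shock_speed_less[OF pos \<rho>'(1) u] S2_shock_speed_greater[OF pos' \<rho>'(2) up] by simp
  then show ?thesis
    by (rule wave_profiles_compose[OF S1_wave_profile[OF pos \<rho>'(1) u] S2_wave_profile[OF pos' \<rho>'(2) up]])
qed

end

theorem mainTheorem5:
  fixes n \<alpha> A B \<rho>m \<rho>p um up :: real
  assumes "1 \<le> n" "n \<le> 3" "0 < \<alpha>" "\<alpha> \<le> 1" "A > 0" "B > 0" "\<rho>m > 0" "\<rho>p > 0"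
  shows
    "((\<rho>p, up) \<in> region_R1R2 n \<alpha> A B (\<rho>m, um) \<longrightarrow>
       (\<exists>V. self_similar_solution n \<alpha> A B (\<rho>m, um) (\<rho>p, up) V \<and>
            wave_followed_by (R1_wave n \<alpha> A B) (R2_wave n \<alpha> A B) V (\<rho>m, um) (\<rho>p, up))) \<and>
     ((\<rho>p, up) \<in> region_R1S2 n \<alpha> A B (\<rho>m, um) \<longrightarrow>
       (\<exists>V. self_similar_solution n \<alpha> A B (\<rho>m, um) (\<rho>p, up) V \<and>
            wave_followed_by (R1_wave n \<alpha> A B) (S2_wave n \<alpha> A B) V (\<rho>m, um) (\<rho>p, up))) \<and>
     ((\<rho>p, up) \<in> region_S1R2 n \<alpha> A B (\<rho>m, um) \<longrightarrow>
       (\<exists>V. self_similar_solution n \<alpha> A B (\<rho>m, um) (\<rho>p, up) V \<and>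
            wave_followed_by (S1_wave n \<alpha> A B) (R2_wave n \<alpha> A B) V (\<rho>m, um) (\<rho>p, up))) \<and>
     ((\<rho>p, up) \<in> region_S1S2 n \<alpha> A B (\<rho>m, um) \<longrightarrow>
       (\<exists>V. self_similar_solution n \<alpha> A B (\<rho>m, um) (\<rho>p, up) V \<and>
            wave_followed_by (S1_wave n \<alpha> A B) (S2_wave n \<alpha> A B) V (\<rho>m, um) (\<rho>p, up)))"
proof -
  interpret chaplygin n \<alpha> A B
    using assms by unfold_locales
  show ?thesis
    using R1R2_solution R1S2_solution S1R2_solution S1S2_solution \<open>\<rho>m > 0\<close> by blast
qed

end
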